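(* Let $k$ be a field, let $\mathfrak{a}$ be a $k$-linear category and consider the characteristic morphism $\chi_{\mathfrak{a}}:HH^2(\mathfrak{a})\to\mathfrak{Z}^2K(\mathfrak{a})$. For every Hochschild $2$-cocycle $c$ of $\mathfrak{a}$ we have $$\chi_{\mathfrak{a}}(c)=(o_C)_{C\in K(\mathfrak{a})},$$ where $o_C\in K(\mathfrak{a})(C,C[2])$ is the obstruction to $c$-deforming $C$ into an object of $K(\mathfrak{a}_c[\epsilon])$.
   Context: Hochschild complex. Graded means $\mathbb{Z}$-graded, with the Koszul sign rule; $[M,N]^p=\prod_i\operatorname{Hom}_k(M^i,N^{i+p})$; $(\Sigma M)^i=M^{i+1}$, and $\sigma m\in\Sigma M$ is the element of degree $|m|-1$ corresponding to $m$. For a quiver $\mathfrak{b}$ (a set of objects and graded $k$-modules $\mathfrak{b}(B,B')$) put $\mathbf{C}_{br}(\mathfrak{b})=\prod_{n\ge0}\prod_{B_0,\dots,B_n}[\Sigma\mathfrak{b}(B_{n-1},B_n)\otimes\cdots\otimes\Sigma\mathfrak{b}(B_0,B_1),\Sigma\mathfrak{b}(B_0,B_n)]$ with braces $\phi\{\phi_1,\dots,\phi_r\}=\sum\phi(1\otimes\cdots\otimes\phi_1\otimes1\otimes\cdots\otimes\phi_r\otimes1\otimes\cdots\otimes1)$ (sum over all order-preserving insertions) and $\langle x,y\rangle=x\{y\}-(-1)^{|x||y|}y\{x\}$. A dg structure is $b\in\mathbf{C}^1_{br}(\mathfrak{b})$ with $b\{b\}=0$ and only components of arity $1,2$ nonzero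 (a linear category has only the component of arity $2$). The Hochschild complex is $\mathbf{C}(\mathfrak{b})=\Sigma^{-1}\mathbf{C}_{br}(\mathfrak{b})$ with differential induced by $\langle b,-\rangle$, and $HH^n(\mathfrak{b})=H^n\mathbf{C}(\mathfrak{b})$. An element $\phi\in\mathbf{C}^{i,n}(\mathfrak{b})=\prod[\mathfrak{b}(B_{n-1},B_n)\otimes\cdots\otimes\mathfrak{b}(B_0,B_1),\mathfrak{b}(B_0,B_n)]^i$ has Hochschild degree $i+n$ and corresponds to the element of $\mathbf{C}_{br}$ sending $(\sigma f_n,\dots,\sigma f_1)$ to $(-1)^{ni+(n-1)|f_n|+\cdots+|f_2|}\sigma\phi(f_n,\dots,f_1)$. Characteristic morphism. $\mathsf{Com}(\mathfrak{a})$ is the dg category of complexes $(C,\delta_C)$ of $\mathfrak{a}$-objects, with $\mathsf{Com}(\mathfrak{a})(C,D)^n=\prod_i\mathfrak{a}(C^i,D^{i+n})$, $(fg)_i=f_{i+|g|}g_i$, $d(f)=\delta f-(-1)^{|f|}f\delta$. $K(\mathfrak{a})=H^0\mathsf{Com}(\mathfrak{a})$ is the homotopy category, so that $K(\mathfrak{a})(C,C[n])=H^n\mathsf{Com}(\mathfrak{a})(C,C)$. $\mathfrak{Z}^nK(\mathfrak{a})$ is the degree $n$ part of the graded centre: families $(\zeta_C)_C$ with $\zeta_C\in K(\mathfrak{a})(C,C[n])$ and $\zeta_{D}f=(-1)^{n|f|}f\zeta_C$ for all graded morphisms $f$ from $C$ to $D$. The differentials determine an arity zero element $\delta\in\mathbf{C}^1(\mathsf{Com}(\mathfrak{a}))$.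 There is a $B_\infty$-morphism $\operatorname{embr}_\delta:\mathbf{C}(\mathfrak{a})\to\mathbf{C}(\mathsf{Com}(\mathfrak{a}))$, given on a cochain $\phi_n$ of arity $n$ by $\sum_{m=0}^n\phi_n\{\delta^{\otimes m}\}$, where $\phi_n$ is regarded as a cochain on $\mathsf{Com}(\mathfrak{a})$ by componentwise application and $\phi_n\{\delta^{\otimes m}\}=\phi_n\{\delta,\dots,\delta\}$ ($m$ copies). The characteristic dg morphism $\mathbf{C}(\mathfrak{a})\to\prod_{C}\mathsf{Com}(\mathfrak{a})(C,C)$ is $\operatorname{embr}_\delta$ followed by projection on the arity zero part; taking cohomology gives the characteristic morphism $\chi_{\mathfrak{a}}:HH^*(\mathfrak{a})\to\mathfrak{Z}^*K(\mathfrak{a})$. For a cocycle $c$, $\chi_{\mathfrak{a}}(c)$ means the value at the class of $c$. Obstruction. Let $c$ be a Hochschild $2$-cocycle of $\mathfrak{a}$, and let $m$ be the composition of $\mathfrak{a}$. $\mathfrak{a}_c[\epsilon]$ is the $k[\epsilon]$-linear category ($\epsilon^2=0$) with the objects of $\mathfrak{a}$, morphism modules $k[\epsilon]\otimes_k\mathfrak{a}(A,A')$ and composition $m+c\,\epsilon$. A $c$-deformation of $C\in K(\mathfrak{a})$ is a lift of $C$ along the functor $k\otimes_{k[\epsilon]}-:K(\mathfrak{a}_c[\epsilon])\to K(\mathfrak{a})$. First order $c$-deformations of $C$ are governed by Lowen's obstruction theory involving $K(\mathfrak{a})(C,C[2])$ and $K(\mathfrak{a})(C,C[1])$; the obstruction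 $o_C$ is the class $[c(\delta_C,\delta_C)]\in K(\mathfrak{a})(C,C[2])$, where $c$ is applied componentwise. It depends on $c$, and $C$ has a $c$-deformation if and only if $o_C=0$.
   Formalization: The obstruction o_C is taken with the sign of the suspended brace c{δ,δ}, i.e. o_C = -[c(δ_C,δ_C)] for c applied componentwise without suspension; with the literal +[c(δ_C,δ_C)] the equation fails outside characteristic 2 under the stated sign conventions. *)

theory Defs
  imports Complex_Main "HOL-Library.FuncSet" "HOL-Library.Function_Algebras"
    "HOL-Library.Product_Plus"
begin

section \<open>Graded quivers and their Hochschild cochains\<close>

text \<open>
  All morphism modules of a quiver are subspaces of one ambient vector space, the type \<open>'m\<close> with
  scalar multiplication \<open>qscale\<close>; they need not be disjoint.  This is no restriction, since any
  family of vector spaces embeds in its direct sum.  \<open>qhom Q A B p\<close> is the degree \<open>p\<close> part of the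
  graded module of morphisms from \<open>A\<close> to \<open>B\<close>.
\<close>

record ('k, 'o, 'm) quiver =
  qob :: "'o set"
  qhom :: "'o \<Rightarrow> 'o \<Rightarrow> int \<Rightarrow> 'm set"
  qscale :: "'k \<Rightarrow> 'm \<Rightarrow> 'm"

text \<open>
  The tuple \<open>(f\<^sub>n, \<dots>, f\<^sub>1)\<close> with \<open>f\<^sub>j\<close> a homogeneous morphism from \<open>B\<^sub>j\<^sub>-\<^sub>1\<close> to \<open>B\<^sub>j\<close> is encoded by the list
  \<open>[B\<^sub>n, \<dots>, B\<^sub>0]\<close> of objects and the list \<open>[(|f\<^sub>n|, f\<^sub>n), \<dots>, (|f\<^sub>1|, f\<^sub>1)]\<close>; the degree is carried along
  because it cannot be recovered from an element of the ambient space.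
\<close>

type_synonym ('o, 'm) cochain = "'o list \<Rightarrow> (int \<times> 'm) list \<Rightarrow> 'm"

definition composable :: "('k, 'o, 'm) quiver \<Rightarrow> 'o list \<Rightarrow> (int \<times> 'm) list \<Rightarrow> bool" where
  "composable Q Bs xs \<longleftrightarrow>
     length Bs = Suc (length xs) \<and> set Bs \<subseteq> qob Q \<and>
     (\<forall>j<length xs. snd (xs ! j) \<in> qhom Q (Bs ! Suc j) (Bs ! j) (fst (xs ! j)))"

definition tdeg :: "(int \<times> 'm) list \<Rightarrow> int" where
  "tdeg xs = sum_list (map fst xs)"

definition bdeg :: "(int \<times> 'm) list \<Rightarrow> int" where
  "bdeg xs = sum_list (map (\<lambda>x. fst x - 1) xs)"

definition multilinear :: "('k, 'o, 'm::ab_group_add) quiver \<Rightarrow> ('o, 'm) cochain \<Rightarrow> bool" where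
  "multilinear Q \<phi> \<longleftrightarrow>
     (\<forall>Bs us p x y vs. composable Q Bs (us @ (p, x) # vs) \<and> composable Q Bs (us @ (p, y) # vs) \<longrightarrow>
        \<phi> Bs (us @ (p, x + y) # vs) = \<phi> Bs (us @ (p, x) # vs) + \<phi> Bs (us @ (p, y) # vs)) \<and>
     (\<forall>Bs us p r x vs. composable Q Bs (us @ (p, x) # vs) \<longrightarrow>
        \<phi> Bs (us @ (p, qscale Q r x) # vs) = qscale Q r (\<phi> Bs (us @ (p, x) # vs)))"

text \<open>
  \<open>cochains Q n\<close> is the degree \<open>n\<close> part of the Hochschild complex: on tuples of length \<open>a\<close> such a
  cochain has internal degree \<open>n - a\<close>, i.e. it lies in \<open>\<^bold>C\<^sup>i\<^sup>,\<^sup>a\<close> with \<open>i + a = n\<close>.  Cochains are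
  normalised to vanish on lists that do not encode composable tuples, so that equality of cochains
  is equality of functions.
\<close>

definition cochains :: "('k, 'o, 'm::ab_group_add) quiver \<Rightarrow> int \<Rightarrow> ('o, 'm) cochain set" where
  "cochains Q n =
     {\<phi>. (\<forall>Bs xs. \<not> composable Q Bs xs \<longrightarrow> \<phi> Bs xs = 0) \<and>
          (\<forall>Bs xs. composable Q Bs xs \<longrightarrow>
             \<phi> Bs xs \<in> qhom Q (last Bs) (hd Bs) (tdeg xs + (n - int (length xs)))) \<and>
          multilinear Q \<phi>}"

definition koszul :: "int \<Rightarrow> 'm::ab_group_add \<Rightarrow> 'm" where
  "koszul s x = (if even s then x else - x)"

text \<open>
  Elements of \<open>\<^bold>C\<^sub>b\<^sub>r\<close> are encoded by the same kind of function, without writing the suspensions: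
  \<open>\<Phi>\<close> encodes \<open>(\<sigma>f\<^sub>n, \<dots>, \<sigma>f\<^sub>1) \<mapsto> \<sigma> \<Phi>(f\<^sub>n, \<dots>, f\<^sub>1)\<close>.  The cochain \<open>\<phi>\<close> of Hochschild degree \<open>n\<close> and arity
  \<open>a\<close>, hence of internal degree \<open>i = n - a\<close>, corresponds to the element \<open>bar n \<phi>\<close> of \<open>\<^bold>C\<^sub>b\<^sub>r\<close> of degree
  \<open>n - 1\<close>, with sign exponent \<open>a i + (a - 1) |f\<^sub>a| + \<dots> + |f\<^sub>2|\<close>.  As \<open>bar n\<close> is an involution, it also
  gives the correspondence in the other direction.
\<close>

definition bar :: "int \<Rightarrow> ('o, 'm::ab_group_add) cochain \<Rightarrow> ('o, 'm) cochain" where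
  "bar n \<phi> Bs xs =
     (let a = length xs in
      koszul (int a * (n - int a) + (\<Sum>j<a. int (a - Suc j) * fst (xs ! j))) (\<phi> Bs xs))"

text \<open>
  \<open>insertions [(|\<psi>\<^sub>1|, \<psi>\<^sub>1), \<dots>, (|\<psi>\<^sub>r|, \<psi>\<^sub>r)] Bs xs\<close> lists, for all \<open>1 \<otimes> \<dots> \<otimes> \<psi>\<^sub>1 \<otimes> 1 \<otimes> \<dots> \<otimes> \<psi>\<^sub>r \<otimes> \<dots> \<otimes> 1\<close>
  that can be applied to the tuple \<open>(Bs, xs)\<close>, the exponent of the Koszul sign and the resulting
  tuple.  Degrees of the \<open>\<psi>\<^sub>i\<close> are degrees in \<open>\<^bold>C\<^sub>b\<^sub>r\<close>; the sign is \<open>|\<psi>\<^sub>i|\<close> times the suspended degrees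
  \<open>|x| - 1\<close> of all entries \<open>x\<close> to the left of the block to which \<open>\<psi>\<^sub>i\<close> is applied, summed over \<open>i\<close>.
  In both equations for a nonempty list of cochains, the first part of the right hand side
  applies \<open>\<psi>\<^sub>1\<close> to the first \<open>l\<close> entries, the second part leaves the first entry untouched.
\<close>

fun insertions :: "(int \<times> ('o, 'm) cochain) list \<Rightarrow> 'o list \<Rightarrow> (int \<times> 'm) list \<Rightarrow>
    (int \<times> 'o list \<times> (int \<times> 'm) list) list" where
  "insertions [] Bs xs = [(0, Bs, xs)]"
| "insertions ((q, \<psi>) # \<Psi>) Bs [] =
     map (\<lambda>(s, Cs, ys). (s, hd Bs # Cs, (q + 1, \<psi> (take 1 Bs) []) # ys)) (insertions \<Psi> Bs [])"
| "insertions ((q, \<psi>) # \<Psi>) Bs (x # xs) =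
     concat (map (\<lambda>l.
        map (\<lambda>(s, Cs, ys).
               (s + bdeg (take l (x # xs)) * sum_list (map fst \<Psi>),
                hd Bs # Cs,
                (bdeg (take l (x # xs)) + q + 1, \<psi> (take (Suc l) Bs) (take l (x # xs))) # ys))
            (insertions \<Psi> (drop l Bs) (drop l (x # xs))))
        [0..<Suc (length (x # xs))]) @
     map (\<lambda>(s, Cs, ys). (s + (fst x - 1) * (q + sum_list (map fst \<Psi>)), hd Bs # Cs, x # ys))
         (insertions ((q, \<psi>) # \<Psi>) (tl Bs) xs)"

definition brace :: "('k, 'o, 'm::ab_group_add) quiver \<Rightarrow> ('o, 'm) cochain \<Rightarrow>
    (int \<times> ('o, 'm) cochain) list \<Rightarrow> ('o, 'm) cochain" where
  "brace Q \<phi> \<Psi> Bs xs =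
     (if composable Q Bs xs
      then sum_list (map (\<lambda>(s, Cs, ys). koszul s (\<phi> Cs ys)) (insertions \<Psi> Bs xs))
      else 0)"

text \<open>\<open>bracket Q p \<phi> q \<psi>\<close> is \<open>\<langle>\<phi>, \<psi>\<rangle>\<close> for \<open>\<phi>\<close>, \<open>\<psi>\<close> of degree \<open>p\<close>, \<open>q\<close> in \<open>\<^bold>C\<^sub>b\<^sub>r\<close>.\<close>

definition bracket :: "('k, 'o, 'm::ab_group_add) quiver \<Rightarrow> int \<Rightarrow> ('o, 'm) cochain \<Rightarrow>
    int \<Rightarrow> ('o, 'm) cochain \<Rightarrow> ('o, 'm) cochain" where
  "bracket Q p \<phi> q \<psi> =
     (\<lambda>Bs xs. brace Q \<phi> [(q, \<psi>)] Bs xs - koszul (p * q) (brace Q \<psi> [(p, \<phi>)] Bs xs))"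

definition hochschild_d :: "('k, 'o, 'm::ab_group_add) quiver \<Rightarrow> ('o, 'm) cochain \<Rightarrow> int \<Rightarrow>
    ('o, 'm) cochain \<Rightarrow> ('o, 'm) cochain" where
  "hochschild_d Q b n \<phi> = bar (n + 1) (bracket Q 1 b (n - 1) (bar n \<phi>))"

definition cocycles :: "('k, 'o, 'm::ab_group_add) quiver \<Rightarrow> ('o, 'm) cochain \<Rightarrow> int \<Rightarrow>
    ('o, 'm) cochain set" where
  "cocycles Q b n = {\<phi> \<in> cochains Q n. hochschild_d Q b n \<phi> = 0}"

definition hochschild_class :: "('k, 'o, 'm::ab_group_add) quiver \<Rightarrow> ('o, 'm) cochain \<Rightarrow> int \<Rightarrow>
    ('o, 'm) cochain \<Rightarrow> ('o, 'm) cochain set" where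
  "hochschild_class Q b n \<phi> =
     {\<psi> \<in> cochains Q n. \<psi> - \<phi> \<in> hochschild_d Q b (n - 1) ` cochains Q (n - 1)}"

definition hochschild_cohomology :: "('k, 'o, 'm::ab_group_add) quiver \<Rightarrow> ('o, 'm) cochain \<Rightarrow> int \<Rightarrow>
    ('o, 'm) cochain set set" where
  "hochschild_cohomology Q b n = hochschild_class Q b n ` cocycles Q b n"


section \<open>Linear categories\<close>

text \<open>
  As for quivers, the Hom-spaces are subspaces of an ambient vector space.  Composition depends on
  the objects: \<open>comp \<aa> A B C g f\<close> is the composite of \<open>f \<in> Hom \<aa> A B\<close> and \<open>g \<in> Hom \<aa> B C\<close>.
\<close>

record ('k, 'o, 'm) lincat =
  Ob :: "'o set"
  Hom :: "'o \<Rightarrow> 'o \<Rightarrow> 'm set"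
  scal :: "'k \<Rightarrow> 'm \<Rightarrow> 'm"
  comp :: "'o \<Rightarrow> 'o \<Rightarrow> 'o \<Rightarrow> 'm \<Rightarrow> 'm \<Rightarrow> 'm"
  ident :: "'o \<Rightarrow> 'm"

locale linear_category =
  fixes \<aa> :: "('k::field, 'o, 'm::ab_group_add) lincat"
  assumes vector_space_ambient: "vector_space (scal \<aa>)"
    and subspace_Hom: "A \<in> Ob \<aa> \<Longrightarrow> B \<in> Ob \<aa> \<Longrightarrow> module.subspace (scal \<aa>) (Hom \<aa> A B)"
    and comp_in_Hom: "\<lbrakk>A \<in> Ob \<aa>; B \<in> Ob \<aa>; C \<in> Ob \<aa>; g \<in> Hom \<aa> B C; f \<in> Hom \<aa> A B\<rbrakk>
      \<Longrightarrow> comp \<aa> A B C g f \<in> Hom \<aa> A C"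
    and comp_add_left: "\<lbrakk>A \<in> Ob \<aa>; B \<in> Ob \<aa>; C \<in> Ob \<aa>; g \<in> Hom \<aa> B C; g' \<in> Hom \<aa> B C; f \<in> Hom \<aa> A B\<rbrakk>
      \<Longrightarrow> comp \<aa> A B C (g + g') f = comp \<aa> A B C g f + comp \<aa> A B C g' f"
    and comp_add_right: "\<lbrakk>A \<in> Ob \<aa>; B \<in> Ob \<aa>; C \<in> Ob \<aa>; g \<in> Hom \<aa> B C; f \<in> Hom \<aa> A B; f' \<in> Hom \<aa> A B\<rbrakk>
      \<Longrightarrow> comp \<aa> A B C g (f + f') = comp \<aa> A B C g f + comp \<aa> A B C g f'"
    and comp_scal_left: "\<lbrakk>A \<in> Ob \<aa>; B \<in> Ob \<aa>; C \<in> Ob \<aa>; g \<in> Hom \<aa> B C; f \<in> Hom \<aa> A B\<rbrakk>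
      \<Longrightarrow> comp \<aa> A B C (scal \<aa> r g) f = scal \<aa> r (comp \<aa> A B C g f)"
    and comp_scal_right: "\<lbrakk>A \<in> Ob \<aa>; B \<in> Ob \<aa>; C \<in> Ob \<aa>; g \<in> Hom \<aa> B C; f \<in> Hom \<aa> A B\<rbrakk>
      \<Longrightarrow> comp \<aa> A B C g (scal \<aa> r f) = scal \<aa> r (comp \<aa> A B C g f)"
    and comp_assoc: "\<lbrakk>A \<in> Ob \<aa>; B \<in> Ob \<aa>; C \<in> Ob \<aa>; D \<in> Ob \<aa>;
        h \<in> Hom \<aa> C D; g \<in> Hom \<aa> B C; f \<in> Hom \<aa> A B\<rbrakk>
      \<Longrightarrow> comp \<aa> A B D (comp \<aa> B C D h g) f = comp \<aa> A C D h (comp \<aa> A B C g f)"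
    and ident_in_Hom: "A \<in> Ob \<aa> \<Longrightarrow> ident \<aa> A \<in> Hom \<aa> A A"
    and comp_ident_left: "\<lbrakk>A \<in> Ob \<aa>; B \<in> Ob \<aa>; f \<in> Hom \<aa> A B\<rbrakk>
      \<Longrightarrow> comp \<aa> A B B (ident \<aa> B) f = f"
    and comp_ident_right: "\<lbrakk>A \<in> Ob \<aa>; B \<in> Ob \<aa>; f \<in> Hom \<aa> A B\<rbrakk>
      \<Longrightarrow> comp \<aa> A A B f (ident \<aa> A) = f"

definition quiver_of :: "('k, 'o, 'm::zero) lincat \<Rightarrow> ('k, 'o, 'm) quiver" where
  "quiver_of \<aa> = \<lparr>qob = Ob \<aa>, qhom = (\<lambda>A B p. if p = 0 then Hom \<aa> A B else {0}), qscale = scal \<aa>\<rparr>"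

definition mult :: "('k, 'o, 'm::zero) lincat \<Rightarrow> ('o, 'm) cochain" where
  "mult \<aa> Bs xs =
     (if composable (quiver_of \<aa>) Bs xs \<and> length xs = 2
      then comp \<aa> (Bs ! 2) (Bs ! 1) (Bs ! 0) (snd (xs ! 0)) (snd (xs ! 1)) else 0)"

abbreviation hh_cochains :: "('k, 'o, 'm::ab_group_add) lincat \<Rightarrow> int \<Rightarrow> ('o, 'm) cochain set" where
  "hh_cochains \<aa> \<equiv> cochains (quiver_of \<aa>)"

abbreviation hh_cocycles :: "('k, 'o, 'm::ab_group_add) lincat \<Rightarrow> int \<Rightarrow> ('o, 'm) cochain set" where
  "hh_cocycles \<aa> \<equiv> cocycles (quiver_of \<aa>) (bar 2 (mult \<aa>))"

abbreviation hh_class :: "('k, 'o, 'm::ab_group_add) lincat \<Rightarrow> int \<Rightarrow> ('o, 'm) cochain \<Rightarrow>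
    ('o, 'm) cochain set" where
  "hh_class \<aa> \<equiv> hochschild_class (quiver_of \<aa>) (bar 2 (mult \<aa>))"

abbreviation HH :: "('k, 'o, 'm::ab_group_add) lincat \<Rightarrow> int \<Rightarrow> ('o, 'm) cochain set set" where
  "HH \<aa> \<equiv> hochschild_cohomology (quiver_of \<aa>) (bar 2 (mult \<aa>))"


section \<open>Complexes and the homotopy category\<close>

type_synonym ('o, 'm) cpx = "(int \<Rightarrow> 'o) \<times> (int \<Rightarrow> 'm)"

definition complexes :: "('k, 'o, 'm::zero) lincat \<Rightarrow> ('o, 'm) cpx set" where
  "complexes \<aa> =
     {(C, \<delta>). \<forall>i. C i \<in> Ob \<aa> \<and> \<delta> i \<in> Hom \<aa> (C i) (C (i + 1)) \<and>
                  comp \<aa> (C i) (C (i + 1)) (C (i + 2)) (\<delta> (i + 1)) (\<delta> i) = 0}"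

definition com_hom :: "('k, 'o, 'm) lincat \<Rightarrow> ('o, 'm) cpx \<Rightarrow> ('o, 'm) cpx \<Rightarrow> int \<Rightarrow> (int \<Rightarrow> 'm) set" where
  "com_hom \<aa> C D n = {f. \<forall>i. f i \<in> Hom \<aa> (fst C i) (fst D (i + n))}"

definition com_quiver :: "('k, 'o, 'm::zero) lincat \<Rightarrow> ('k, ('o, 'm) cpx, int \<Rightarrow> 'm) quiver" where
  "com_quiver \<aa> = \<lparr>qob = complexes \<aa>, qhom = com_hom \<aa>, qscale = (\<lambda>r f i. scal \<aa> r (f i))\<rparr>"

text \<open>\<open>com_comp \<aa> C D E q g p f\<close> is the composite of \<open>f\<close>, of degree \<open>p\<close>, and \<open>g\<close>, of degree \<open>q\<close>.\<close>

definition com_comp :: "('k, 'o, 'm) lincat \<Rightarrow> ('o, 'm) cpx \<Rightarrow> ('o, 'm) cpx \<Rightarrow> ('o, 'm) cpx \<Rightarrow>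
    int \<Rightarrow> (int \<Rightarrow> 'm) \<Rightarrow> int \<Rightarrow> (int \<Rightarrow> 'm) \<Rightarrow> int \<Rightarrow> 'm" where
  "com_comp \<aa> C D E q g p f =
     (\<lambda>i. comp \<aa> (fst C i) (fst D (i + p)) (fst E (i + p + q)) (g (i + p)) (f i))"

definition com_d :: "('k, 'o, 'm::ab_group_add) lincat \<Rightarrow> ('o, 'm) cpx \<Rightarrow> ('o, 'm) cpx \<Rightarrow> int \<Rightarrow>
    (int \<Rightarrow> 'm) \<Rightarrow> int \<Rightarrow> 'm" where
  "com_d \<aa> C D n f =
     com_comp \<aa> C D D 1 (snd D) n f - koszul n (com_comp \<aa> C C D n f 1 (snd C))"

definition com_cocycles :: "('k, 'o, 'm::ab_group_add) lincat \<Rightarrow> ('o, 'm) cpx \<Rightarrow> ('o, 'm) cpx \<Rightarrow>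
    int \<Rightarrow> (int \<Rightarrow> 'm) set" where
  "com_cocycles \<aa> C D n = {f \<in> com_hom \<aa> C D n. com_d \<aa> C D n f = 0}"

definition com_class :: "('k, 'o, 'm::ab_group_add) lincat \<Rightarrow> ('o, 'm) cpx \<Rightarrow> ('o, 'm) cpx \<Rightarrow>
    int \<Rightarrow> (int \<Rightarrow> 'm) \<Rightarrow> (int \<Rightarrow> 'm) set" where
  "com_class \<aa> C D n f =
     {g \<in> com_hom \<aa> C D n. g - f \<in> com_d \<aa> C D (n - 1) ` com_hom \<aa> C D (n - 1)}"

text \<open>\<open>K_hom \<aa> C D n\<close> is \<open>K(\<aa>)(C, D[n])\<close>, realised as \<open>H\<^sup>n Com(\<aa>)(C, D)\<close>.\<close>

definition K_hom :: "('k, 'o, 'm::ab_group_add) lincat \<Rightarrow> ('o, 'm) cpx \<Rightarrow> ('o, 'm) cpx \<Rightarrow>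
    int \<Rightarrow> (int \<Rightarrow> 'm) set set" where
  "K_hom \<aa> C D n = com_class \<aa> C D n ` com_cocycles \<aa> C D n"

definition graded_centre :: "('k, 'o, 'm::ab_group_add) lincat \<Rightarrow> int \<Rightarrow>
    (('o, 'm) cpx \<Rightarrow> (int \<Rightarrow> 'm) set) set" where
  "graded_centre \<aa> n =
     {\<zeta> \<in> (\<Pi>\<^sub>E C\<in>complexes \<aa>. K_hom \<aa> C C n).
        \<forall>C\<in>complexes \<aa>. \<forall>D\<in>complexes \<aa>. \<forall>p. \<forall>f\<in>com_cocycles \<aa> C D p. \<forall>x\<in>\<zeta> C. \<forall>y\<in>\<zeta> D.
          com_class \<aa> C D (p + n) (com_comp \<aa> C D D n y p f) =
          com_class \<aa> C D (p + n) (koszul (n * p) (com_comp \<aa> C C D p f n x))}"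


section \<open>The characteristic morphism\<close>

text \<open>
  \<open>componentwise \<aa> \<phi>\<close> is \<open>\<phi>\<close> as a cochain on \<open>Com(\<aa>)\<close>: in position \<open>i\<close>, the factor \<open>f\<^sub>j\<close> of
  \<open>(f\<^sub>n, \<dots>, f\<^sub>1)\<close> is taken in position \<open>i + |f\<^sub>1| + \<dots> + |f\<^sub>j\<^sub>-\<^sub>1|\<close>.
\<close>

definition componentwise :: "('k, 'o, 'm::ab_group_add) lincat \<Rightarrow> ('o, 'm) cochain \<Rightarrow>
    (('o, 'm) cpx, int \<Rightarrow> 'm) cochain" where
  "componentwise \<aa> \<phi> Bs xs =
     (if composable (com_quiver \<aa>) Bs xs
      then (\<lambda>i. \<phi> (map (\<lambda>j. fst (Bs ! j) (i + tdeg (drop j xs))) [0..<length Bs])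
                  (map (\<lambda>j. (0, snd (xs ! j) (i + tdeg (drop (Suc j) xs)))) [0..<length xs]))
      else 0)"

definition delta :: "('k, 'o, 'm::ab_group_add) lincat \<Rightarrow> (('o, 'm) cpx, int \<Rightarrow> 'm) cochain" where
  "delta \<aa> Bs xs = (if composable (com_quiver \<aa>) Bs xs \<and> xs = [] then snd (hd Bs) else 0)"

text \<open>
  A degree \<open>n\<close> Hochschild cochain of a linear category is concentrated in arity \<open>n\<close>.  The element
  \<open>\<delta>\<close> has Hochschild degree \<open>1\<close>, hence degree \<open>0\<close> in \<open>\<^bold>C\<^sub>b\<^sub>r\<close>.
\<close>

definition embr :: "('k, 'o, 'm::ab_group_add) lincat \<Rightarrow> int \<Rightarrow> ('o, 'm) cochain \<Rightarrow>
    (('o, 'm) cpx, int \<Rightarrow> 'm) cochain" where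
  "embr \<aa> n \<phi> =
     bar n (\<lambda>Bs xs. \<Sum>m=0..nat n.
       brace (com_quiver \<aa>) (bar n (componentwise \<aa> \<phi>)) (replicate m (0, bar 1 (delta \<aa>))) Bs xs)"

definition char_cochain :: "('k, 'o, 'm::ab_group_add) lincat \<Rightarrow> int \<Rightarrow> ('o, 'm) cochain \<Rightarrow>
    ('o, 'm) cpx \<Rightarrow> int \<Rightarrow> 'm" where
  "char_cochain \<aa> n \<phi> C = embr \<aa> n \<phi> [C] []"

text \<open>
  On a cohomology class \<open>X\<close>: the common class of the images of all representatives of \<open>X\<close>.
\<close>

definition char_morphism :: "('k, 'o, 'm::ab_group_add) lincat \<Rightarrow> int \<Rightarrow> ('o, 'm) cochain set \<Rightarrow>
    ('o, 'm) cpx \<Rightarrow> (int \<Rightarrow> 'm) set" where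
  "char_morphism \<aa> n X =
     (\<lambda>C\<in>complexes \<aa>. the_elem ((\<lambda>\<phi>. com_class \<aa> C C n (char_cochain \<aa> n \<phi> C)) ` X))"


section \<open>Obstructions\<close>

text \<open>
  \<open>\<aa>\<^sub>c[\<epsilon>]\<close>, with \<open>(f, f')\<close> standing for \<open>f + f' \<epsilon>\<close>.  Only the underlying \<open>k\<close>-linear structure is
  recorded; \<open>\<epsilon>\<close> acts by \<open>(f, f') \<mapsto> (0, f)\<close>.  The cocycle \<open>c\<close> is not assumed to be normalised, whence
  the correction term in the identities.
\<close>

definition deformation :: "('k, 'o, 'm::ab_group_add) lincat \<Rightarrow> ('o, 'm) cochain \<Rightarrow>
    ('k, 'o, 'm \<times> 'm) lincat" where
  "deformation \<aa> c =
     \<lparr>Ob = Ob \<aa>,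
      Hom = (\<lambda>A B. Hom \<aa> A B \<times> Hom \<aa> A B),
      scal = (\<lambda>r (f, f'). (scal \<aa> r f, scal \<aa> r f')),
      comp = (\<lambda>A B C (g, g') (f, f').
        (comp \<aa> A B C g f,
         comp \<aa> A B C g f' + comp \<aa> A B C g' f + c [C, B, A] [(0, g), (0, f)])),
      ident = (\<lambda>A. (ident \<aa> A, - c [A, A, A] [(0, ident \<aa> A), (0, ident \<aa> A)]))\<rparr>"

definition K_iso :: "('k, 'o, 'm::ab_group_add) lincat \<Rightarrow> ('o, 'm) cpx \<Rightarrow> ('o, 'm) cpx \<Rightarrow> bool" where
  "K_iso \<aa> C D \<longleftrightarrow>
     (\<exists>f\<in>com_cocycles \<aa> C D 0. \<exists>g\<in>com_cocycles \<aa> D C 0.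
        com_class \<aa> C C 0 (com_comp \<aa> C D C 0 g 0 f) = com_class \<aa> C C 0 (\<lambda>i. ident \<aa> (fst C i)) \<and>
        com_class \<aa> D D 0 (com_comp \<aa> D C D 0 f 0 g) = com_class \<aa> D D 0 (\<lambda>i. ident \<aa> (fst D i)))"

definition has_c_deformation :: "('k, 'o, 'm::ab_group_add) lincat \<Rightarrow> ('o, 'm) cochain \<Rightarrow>
    ('o, 'm) cpx \<Rightarrow> bool" where
  "has_c_deformation \<aa> c C \<longleftrightarrow>
     (\<exists>(D, \<delta>)\<in>complexes (deformation \<aa> c). K_iso \<aa> (D, fst \<circ> \<delta>) C)"

text \<open>
  The class \<open>[c(\<delta>\<^sub>C, \<delta>\<^sub>C)]\<close>, where \<open>\<delta>\<^sub>C\<close> and the extension of \<open>c\<close> to \<open>Com(\<aa>)\<close> are taken in \<open>\<^bold>C\<^sub>b\<^sub>r\<close>, as in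
  the brace \<open>c{\<delta>, \<delta>}\<close>.  As \<open>|\<delta>\<^sub>C| = 1\<close>, the sign in \<open>bar\<close> is not trivial here: unsuspended, the
  cochain is the negative of \<open>i \<mapsto> c(\<delta>\<^sub>C\<^sup>i\<^sup>+\<^sup>1, \<delta>\<^sub>C\<^sup>i)\<close> (see \<open>obstruction_cochain_eq\<close>).  It is the cochain
  that \<open>h\<close> has to bound for \<open>\<delta>\<^sub>C + h \<epsilon>\<close> to be a differential over \<open>\<aa>\<^sub>c[\<epsilon>]\<close> (see
  \<open>c_deformation_strict_iff\<close>).
\<close>

definition obstruction_cochain :: "('k, 'o, 'm::ab_group_add) lincat \<Rightarrow> ('o, 'm) cochain \<Rightarrow>
    ('o, 'm) cpx \<Rightarrow> int \<Rightarrow> 'm" where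
  "obstruction_cochain \<aa> c C = bar 2 (componentwise \<aa> c) [C, C, C] [(1, snd C), (1, snd C)]"

definition obstruction :: "('k, 'o, 'm::ab_group_add) lincat \<Rightarrow> ('o, 'm) cochain \<Rightarrow>
    ('o, 'm) cpx \<Rightarrow> (int \<Rightarrow> 'm) set" where
  "obstruction \<aa> c C = com_class \<aa> C C 2 (obstruction_cochain \<aa> c C)"


section \<open>The obstruction classes decide the existence of deformations and are central\<close>

lemma less_Suc_nat: "(\<forall>j<Suc n. P j) \<longleftrightarrow> P 0 \<and> (\<forall>j<n. P (Suc j))" by (auto simp: less_Suc_eq_0_disj)

lemma composable_Nil: "composable Q Bs [] \<longleftrightarrow> (\<exists>B\<in>qob Q. Bs = [B])"
  by (cases Bs) (auto simp: composable_def)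

lemma composable_Cons: "composable Q Bs (x # xs) \<longleftrightarrow> (\<exists>B Cs. Bs = B # Cs \<and> B \<in> qob Q \<and> snd x \<in> qhom Q (hd Cs) B (fst x) \<and> composable Q Cs xs)"
proof (cases Bs)
  case (Cons B Cs)
  then show ?thesis by (cases Cs) (auto simp: composable_def less_Suc_nat)
qed (auto simp: composable_def)

lemma composable_3: "composable Q [D,C,B,A] [h,g,f] \<longleftrightarrow> {A,B,C,D} \<subseteq> qob Q \<and> snd h \<in> qhom Q C D (fst h) \<and> snd g \<in> qhom Q B C (fst g) \<and> snd f \<in> qhom Q A B (fst f)"
  by (auto simp: composable_Cons composable_Nil)
lemma composable_2: "composable Q [C,B,A] [g,f] \<longleftrightarrow> {A,B,C} \<subseteq> qob Q  \<and> snd g \<in> qhom Q B C (fst g) \<and> snd f \<in> qhom Q A B (fst f)"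
  by (auto simp: composable_Cons composable_Nil)
lemma koszul_0 [simp]: "koszul k 0 = 0" by (simp add: koszul_def)

context linear_category begin

interpretation vs: vector_space "scal \<aa>" by (rule vector_space_ambient)

lemma H0: "A \<in> Ob \<aa> \<Longrightarrow> B \<in> Ob \<aa> \<Longrightarrow> 0 \<in> Hom \<aa> A B"
  and Hadd: "A \<in> Ob \<aa> \<Longrightarrow> B \<in> Ob \<aa> \<Longrightarrow> f \<in> Hom \<aa> A B \<Longrightarrow> g \<in> Hom \<aa> A B \<Longrightarrow> f + g \<in> Hom \<aa> A B"
  and Hneg: "A \<in> Ob \<aa> \<Longrightarrow> B \<in> Ob \<aa> \<Longrightarrow> f \<in> Hom \<aa> A B \<Longrightarrow> - f \<in> Hom \<aa> A B"
  and Hdiff: "A \<in> Ob \<aa> \<Longrightarrow> B \<in> Ob \<aa> \<Longrightarrow> f \<in> Hom \<aa> A B \<Longrightarrow> g \<in> Hom \<aa> A B \<Longrightarrow> f - g \<in> Hom \<aa> A B"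
  and Hscal: "A \<in> Ob \<aa> \<Longrightarrow> B \<in> Ob \<aa> \<Longrightarrow> f \<in> Hom \<aa> A B \<Longrightarrow> scal \<aa> r f \<in> Hom \<aa> A B"
  using vs.subspace_0[OF subspace_Hom[of A B]] vs.subspace_add[OF subspace_Hom[of A B], of f g] vs.subspace_neg[OF subspace_Hom[of A B], of f]
   vs.subspace_diff[OF subspace_Hom[of A B], of f g] vs.subspace_scale[OF subspace_Hom[of A B], of f r]
  by simp_all

lemma
  assumes "A \<in> Ob \<aa>" "B \<in> Ob \<aa>" "C \<in> Ob \<aa>"
  shows comp0l: "f \<in> Hom \<aa> A B \<Longrightarrow> comp \<aa> A B C 0 f = 0"
  and comp0r: "g \<in> Hom \<aa> B C \<Longrightarrow> comp \<aa> A B C g 0 = 0"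
  and compnl: "f \<in> Hom \<aa> A B \<Longrightarrow> g \<in> Hom \<aa> B C \<Longrightarrow> comp \<aa> A B C (- g) f = - comp \<aa> A B C g f"
  and compnr: "f \<in> Hom \<aa> A B \<Longrightarrow> g \<in> Hom \<aa> B C \<Longrightarrow> comp \<aa> A B C g (- f) = - comp \<aa> A B C g f"
proof -
  show "f \<in> Hom \<aa> A B \<Longrightarrow> comp \<aa> A B C 0 f = 0" for f
    using comp_scal_left[OF assms H0[OF assms(2,3)], of f 0] by simp
  show "g \<in> Hom \<aa> B C \<Longrightarrow> comp \<aa> A B C g 0 = 0" for g
    using comp_scal_right[OF assms _ H0[OF assms(1,2)], of g 0] by simp
  show "f \<in> Hom \<aa> A B \<Longrightarrow> g \<in> Hom \<aa> B C \<Longrightarrow> comp \<aa> A B C (- g) f = - comp \<aa> A B C g f"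
    using comp_scal_left[OF assms, of g f "-1"] by simp
  show "f \<in> Hom \<aa> A B \<Longrightarrow> g \<in> Hom \<aa> B C \<Longrightarrow> comp \<aa> A B C g (- f) = - comp \<aa> A B C g f"
    using comp_scal_right[OF assms, of g f "-1"] by simp
qed

lemma
  assumes "A \<in> Ob \<aa>" "B \<in> Ob \<aa>" "C \<in> Ob \<aa>"
  shows compdl: "f \<in> Hom \<aa> A B \<Longrightarrow> g \<in> Hom \<aa> B C \<Longrightarrow> g' \<in> Hom \<aa> B C \<Longrightarrow> comp \<aa> A B C (g - g') f = comp \<aa> A B C g f - comp \<aa> A B C g' f"
  and compdr: "f \<in> Hom \<aa> A B \<Longrightarrow> f' \<in> Hom \<aa> A B \<Longrightarrow> g \<in> Hom \<aa> B C \<Longrightarrow> comp \<aa> A B C g (f - f') = comp \<aa> A B C g f - comp \<aa> A B C g f'"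
  using comp_add_left[OF assms, of g "- g'" f] comp_add_right[OF assms, of g f "- f'"] assms
  by (simp_all add: compnl compnr Hneg)

lemma coch2:
  assumes c: "c \<in> hh_cochains \<aa> 2" and ob: "X \<in> Ob \<aa>" "Y \<in> Ob \<aa>" "Z \<in> Ob \<aa>"
  shows c2_in: "g \<in> Hom \<aa> Y Z \<Longrightarrow> f \<in> Hom \<aa> X Y \<Longrightarrow> c [Z,Y,X] [(0,g),(0,f)] \<in> Hom \<aa> X Z"
   and c2_addl: "g \<in> Hom \<aa> Y Z \<Longrightarrow> g' \<in> Hom \<aa> Y Z \<Longrightarrow> f \<in> Hom \<aa> X Y \<Longrightarrow>
     c [Z,Y,X] [(0,g + g'),(0,f)] = c [Z,Y,X] [(0,g),(0,f)] + c [Z,Y,X] [(0,g'),(0,f)]"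
   and c2_addr: "g \<in> Hom \<aa> Y Z \<Longrightarrow> f \<in> Hom \<aa> X Y \<Longrightarrow> f' \<in> Hom \<aa> X Y \<Longrightarrow>
     c [Z,Y,X] [(0,g),(0,f + f')] = c [Z,Y,X] [(0,g),(0,f)] + c [Z,Y,X] [(0,g),(0,f')]"
   and c2_scal: "g \<in> Hom \<aa> Y Z \<Longrightarrow> f \<in> Hom \<aa> X Y \<Longrightarrow>
     c [Z,Y,X] [(0,scal \<aa> r g),(0,f)] = scal \<aa> r (c [Z,Y,X] [(0,g),(0,f)])"
   and c2_scar: "g \<in> Hom \<aa> Y Z \<Longrightarrow> f \<in> Hom \<aa> X Y \<Longrightarrow>
     c [Z,Y,X] [(0,g),(0,scal \<aa> r f)] = scal \<aa> r (c [Z,Y,X] [(0,g),(0,f)])"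
proof -
  let ?Q = "quiver_of \<aa>"
  have cm: "composable ?Q [Z,Y,X] [(0,g),(0,f)]" if "g \<in> Hom \<aa> Y Z" "f \<in> Hom \<aa> X Y" for f g
    using that ob by (simp add: composable_2 quiver_of_def)
  have m: "\<And>Bs xs. composable ?Q Bs xs \<Longrightarrow> c Bs xs \<in> qhom ?Q (last Bs) (hd Bs) (tdeg xs + (2 - int (length xs)))"
    and a: "\<And>Bs us p x y vs. composable ?Q Bs (us @ (p, x) # vs) \<Longrightarrow> composable ?Q Bs (us @ (p, y) # vs) \<Longrightarrow>
        c Bs (us @ (p, x + y) # vs) = c Bs (us @ (p, x) # vs) + c Bs (us @ (p, y) # vs)"
    and s: "\<And>Bs us p r x vs. composable ?Q Bs (us @ (p, x) # vs) \<Longrightarrow>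
        c Bs (us @ (p, qscale ?Q r x) # vs) = qscale ?Q r (c Bs (us @ (p, x) # vs))"
    using c unfolding cochains_def multilinear_def by blast+
  show "g \<in> Hom \<aa> Y Z \<Longrightarrow> f \<in> Hom \<aa> X Y \<Longrightarrow> c [Z,Y,X] [(0,g),(0,f)] \<in> Hom \<aa> X Z"
    using m[OF cm, of g f] by (simp add: quiver_of_def tdeg_def)
  show "g \<in> Hom \<aa> Y Z \<Longrightarrow> g' \<in> Hom \<aa> Y Z \<Longrightarrow> f \<in> Hom \<aa> X Y \<Longrightarrow>
     c [Z,Y,X] [(0,g + g'),(0,f)] = c [Z,Y,X] [(0,g),(0,f)] + c [Z,Y,X] [(0,g'),(0,f)]"
    using a[of _ "[]"] cm by simp
  show "g \<in> Hom \<aa> Y Z \<Longrightarrow> f \<in> Hom \<aa> X Y \<Longrightarrow> f' \<in> Hom \<aa> X Y \<Longrightarrow>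
     c [Z,Y,X] [(0,g),(0,f + f')] = c [Z,Y,X] [(0,g),(0,f)] + c [Z,Y,X] [(0,g),(0,f')]"
    using a[of _ "[(0,g)]" 0 f "[]"] cm by simp
  show "g \<in> Hom \<aa> Y Z \<Longrightarrow> f \<in> Hom \<aa> X Y \<Longrightarrow>
     c [Z,Y,X] [(0,scal \<aa> r g),(0,f)] = scal \<aa> r (c [Z,Y,X] [(0,g),(0,f)])"
    using s[of _ "[]"] cm by (simp add: quiver_of_def)
  show "g \<in> Hom \<aa> Y Z \<Longrightarrow> f \<in> Hom \<aa> X Y \<Longrightarrow>
     c [Z,Y,X] [(0,g),(0,scal \<aa> r f)] = scal \<aa> r (c [Z,Y,X] [(0,g),(0,f)])"
    using s[of _ "[(0,g)]" 0 f "[]"] cm by (simp add: quiver_of_def)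
qed

lemma concentrated:
  assumes c: "c \<in> hh_cochains \<aa> n" and l: "int (length xs) \<noteq> n"
  shows "c Bs xs = 0"
proof (cases "composable (quiver_of \<aa>) Bs xs")
  case False then show ?thesis using c by (auto simp: cochains_def)
next
  case True
  let ?Q = "quiver_of \<aa>"
  show ?thesis
  proof (cases "\<forall>x\<in>set xs. fst x = 0")
    case t: True
    have "tdeg xs = 0" unfolding tdeg_def using t by (induction xs) auto
    moreover have "c Bs xs \<in> qhom ?Q (last Bs) (hd Bs) (tdeg xs + (n - int (length xs)))"
      using c True by (auto simp: cochains_def)
    ultimately show ?thesis using l by (simp add: quiver_of_def)
  next
    case False
    then obtain us p x vs where xs: "xs = us @ (p,x) # vs" and p: "p \<noteq> 0"
      by (metis in_set_conv_decomp surj_pair fst_conv)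
    have "snd (xs ! length us) \<in> qhom ?Q (Bs ! Suc (length us)) (Bs ! length us) (fst (xs ! length us))"
      using True xs unfolding composable_def by (metis add_Suc_right length_append length_Cons less_add_Suc1)
    then have x: "x = 0" using xs p by (simp add: quiver_of_def)
    have "c Bs (us @ (p, qscale ?Q 0 x) # vs) = qscale ?Q 0 (c Bs (us @ (p, x) # vs))"
      using c True xs unfolding cochains_def multilinear_def by blast
    then show ?thesis using xs x by (simp add: quiver_of_def)
  qed
qed

lemma mult_conc: "length xs \<noteq> 2 \<Longrightarrow> mult \<aa> Bs xs = 0"
  by (simp add: mult_def)

lemma mult2: "X \<in> Ob \<aa> \<Longrightarrow> Y \<in> Ob \<aa> \<Longrightarrow> Z \<in> Ob \<aa> \<Longrightarrow> g \<in> Hom \<aa> Y Z \<Longrightarrow> f \<in> Hom \<aa> X Y \<Longrightarrow>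
   mult \<aa> [Z,Y,X] [(0,g),(0,f)] = comp \<aa> X Y Z g f"
  by (simp add: mult_def composable_2 quiver_of_def)

lemma c_cocycle:
  assumes c: "c \<in> hh_cocycles \<aa> 2" and ob: "W \<in> Ob \<aa>" "X \<in> Ob \<aa>" "Y \<in> Ob \<aa>" "Z \<in> Ob \<aa>"
   and h: "h \<in> Hom \<aa> Y Z" and g: "g \<in> Hom \<aa> X Y" and f: "f \<in> Hom \<aa> W X"
  shows "comp \<aa> W Y Z h (c [Y,X,W] [(0,g),(0,f)]) - c [Z,X,W] [(0,comp \<aa> X Y Z h g),(0,f)]
     + c [Z,Y,W] [(0,h),(0,comp \<aa> W X Y g f)] - comp \<aa> W X Z (c [Z,Y,X] [(0,h),(0,g)]) f = 0"
proof -
  have c': "c \<in> hh_cochains \<aa> 2" using c by (simp add: cocycles_def)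
  have "hochschild_d (quiver_of \<aa>) (bar 2 (mult \<aa>)) 2 c [Z,Y,X,W] [(0,h),(0,g),(0,f)] = 0"
    using c unfolding cocycles_def by auto
  moreover have "c [Z, Y, X] [(0, h), (0, g)] \<in> Hom \<aa> X Z" "c [Y,X,W] [(0,g),(0,f)] \<in> Hom \<aa> W Y"
    using coch2(1)[OF c'] ob f g h by auto
  ultimately show ?thesis using ob f g h
    by (simp add: hochschild_d_def bracket_def brace_def bar_def koszul_def composable_3 composable_2
     quiver_of_def[of \<aa>, THEN arg_cong[of _ _ qob]] quiver_of_def[of \<aa>, THEN arg_cong[of _ _ qhom]]
     Let_def upt_rec[of _ "Suc _"] bdeg_def mult_conc mult2 concentrated[OF c'] comp_in_Hom lessThan_Suc
     algebra_simps)
qed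

lemma cpx:
  assumes "C \<in> complexes \<aa>"
  shows cpx_ob: "fst C i \<in> Ob \<aa>" and cpx_d: "snd C i \<in> Hom \<aa> (fst C i) (fst C (i+1))"
    and cpx_dd: "comp \<aa> (fst C i) (fst C (i + 1)) (fst C (i + 2)) (snd C (i + 1)) (snd C i) = 0"
  using assms by (auto simp: complexes_def)

lemma cpx_d': "C \<in> complexes \<aa> \<Longrightarrow> snd C \<in> com_hom \<aa> C C 1"
  by (simp add: com_hom_def cpx_d)

lemma obstruction_cochain_eq:
  assumes c: "C \<in> complexes \<aa>"
  shows "obstruction_cochain \<aa> c C =
     - (\<lambda>i. c [fst C (i+2), fst C (i+1), fst C i] [(0,snd C (i+1)), (0,snd C i)])"
  using c by (simp add: obstruction_cochain_def bar_def koszul_def lessThan_Suc numeral_2_eq_2 componentwise_def composable_2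
    com_quiver_def cpx_d' tdeg_def upt_rec[of _ "Suc _"] fun_eq_iff)

lemma com_homD: "f \<in> com_hom \<aa> C D n \<Longrightarrow> f i \<in> Hom \<aa> (fst C i) (fst D (i + n))"
  by (simp add: com_hom_def)
lemma com_hom_ops:
  assumes "C \<in> complexes \<aa>" "D \<in> complexes \<aa>"
  shows "0 \<in> com_hom \<aa> C D n" 
    "f \<in> com_hom \<aa> C D n \<Longrightarrow> g \<in> com_hom \<aa> C D n \<Longrightarrow> f + g \<in> com_hom \<aa> C D n"
    "f \<in> com_hom \<aa> C D n \<Longrightarrow> - f \<in> com_hom \<aa> C D n"
    "f \<in> com_hom \<aa> C D n \<Longrightarrow> g \<in> com_hom \<aa> C D n \<Longrightarrow> f - g \<in> com_hom \<aa> C D n"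
    "f \<in> com_hom \<aa> C D n \<Longrightarrow> koszul k f \<in> com_hom \<aa> C D n"
  using assms by (auto simp: com_hom_def koszul_def intro!: H0 Hadd Hneg Hdiff cpx_ob)

lemma com_comp_in:
  assumes "C \<in> complexes \<aa>" "D \<in> complexes \<aa>" "E \<in> complexes \<aa>"
   "g \<in> com_hom \<aa> D E q" "f \<in> com_hom \<aa> C D p" "n = p + q"
  shows "com_comp \<aa> C D E q g p f \<in> com_hom \<aa> C E n"
  using assms by (auto simp: com_hom_def com_comp_def add.assoc[symmetric] intro!: comp_in_Hom cpx_ob)

lemma com_comp_add:
  assumes "C \<in> complexes \<aa>" "D \<in> complexes \<aa>" "E \<in> complexes \<aa>"
   "g \<in> com_hom \<aa> D E q" "f \<in> com_hom \<aa> C D p" 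
  shows "g' \<in> com_hom \<aa> D E q \<Longrightarrow> com_comp \<aa> C D E q (g + g') p f = com_comp \<aa> C D E q g p f + com_comp \<aa> C D E q g' p f"
   "f' \<in> com_hom \<aa> C D p \<Longrightarrow> com_comp \<aa> C D E q g p (f + f') = com_comp \<aa> C D E q g p f + com_comp \<aa> C D E q g p f'"
   "com_comp \<aa> C D E q (- g) p f = - com_comp \<aa> C D E q g p f"
   "com_comp \<aa> C D E q g p (- f) = - com_comp \<aa> C D E q g p f"
  using assms by (auto simp: com_hom_def com_comp_def fun_eq_iff comp_add_left comp_add_right compnl compnr cpx_ob)

lemma com_comp_diff:
  assumes "C \<in> complexes \<aa>" "D \<in> complexes \<aa>" "E \<in> complexes \<aa>"
   "g \<in> com_hom \<aa> D E q" "f \<in> com_hom \<aa> C D p" 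
  shows "g' \<in> com_hom \<aa> D E q \<Longrightarrow> com_comp \<aa> C D E q (g - g') p f = com_comp \<aa> C D E q g p f - com_comp \<aa> C D E q g' p f"
   "f' \<in> com_hom \<aa> C D p \<Longrightarrow> com_comp \<aa> C D E q g p (f - f') = com_comp \<aa> C D E q g p f - com_comp \<aa> C D E q g p f'"
  using assms by (auto simp: com_hom_def com_comp_def fun_eq_iff compdl compdr cpx_ob)

lemma com_comp_zero:
  assumes "C \<in> complexes \<aa>" "D \<in> complexes \<aa>" "E \<in> complexes \<aa>"
  shows "f \<in> com_hom \<aa> C D p \<Longrightarrow> com_comp \<aa> C D E q 0 p f = 0"
   "g \<in> com_hom \<aa> D E q  \<Longrightarrow> com_comp \<aa> C D E q g p 0 = 0"
  using assms by (auto simp: com_hom_def com_comp_def fun_eq_iff comp0l comp0r cpx_ob)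

lemma com_assoc:
  assumes "B \<in> complexes \<aa>" "C \<in> complexes \<aa>" "D \<in> complexes \<aa>" "E \<in> complexes \<aa>"
   "h \<in> com_hom \<aa> D E r" "g \<in> com_hom \<aa> C D q" "f \<in> com_hom \<aa> B C p" "n = q + r" "m = p + q"
  shows "com_comp \<aa> B C E n (com_comp \<aa> C D E r h q g) p f = com_comp \<aa> B D E r h m (com_comp \<aa> B C D q g p f)"
  using assms comp_assoc[OF cpx_ob cpx_ob cpx_ob cpx_ob com_homD com_homD com_homD, OF assms(1-7)]
  by (auto simp: com_comp_def fun_eq_iff add.assoc[symmetric])

lemma com_d_in:
  assumes "C \<in> complexes \<aa>" "D \<in> complexes \<aa>" "f \<in> com_hom \<aa> C D p" "n = p + 1"
  shows "com_d \<aa> C D p f \<in> com_hom \<aa> C D n"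
  unfolding com_d_def using assms 
  by (intro com_hom_ops com_comp_in cpx_d') auto

lemma com_d_add:
  assumes "C \<in> complexes \<aa>" "D \<in> complexes \<aa>" "f \<in> com_hom \<aa> C D p" "g \<in> com_hom \<aa> C D p"
  shows "com_d \<aa> C D p (f + g) = com_d \<aa> C D p f + com_d \<aa> C D p g"
    "com_d \<aa> C D p (- f) = - com_d \<aa> C D p f"
    "com_d \<aa> C D p (f - g) = com_d \<aa> C D p f - com_d \<aa> C D p g"
  unfolding com_d_def using assms 
  by (auto simp: com_comp_add com_comp_diff cpx_d' koszul_def)

lemma com_d_0: "C \<in> complexes \<aa> \<Longrightarrow> D \<in> complexes \<aa> \<Longrightarrow> com_d \<aa> C D p 0 = 0"
  by (simp add: com_d_def com_comp_zero cpx_d' koszul_def)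

lemma leibniz:
  assumes CDE: "C \<in> complexes \<aa>" "D \<in> complexes \<aa>" "E \<in> complexes \<aa>"
   "g \<in> com_hom \<aa> D E q" "f \<in> com_hom \<aa> C D p" "n = p + q" "p' = p + 1" "q' = q + 1"
  shows "com_d \<aa> C E n (com_comp \<aa> C D E q g p f) =
    com_comp \<aa> C D E q' (com_d \<aa> D E q g) p f + koszul q (com_comp \<aa> C D E q g p' (com_d \<aa> C D p f))"
proof -
  note d = cpx_d'[OF CDE(1)] cpx_d'[OF CDE(2)] cpx_d'[OF CDE(3)]
  have a: "com_comp \<aa> C E E 1 (snd E) n (com_comp \<aa> C D E q g p f) = com_comp \<aa> C D E q' (com_comp \<aa> D E E 1 (snd E) q g) p f"
    using assms d by (intro com_assoc[symmetric]) auto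
  have b: "com_comp \<aa> C C E n (com_comp \<aa> C D E q g p f) 1 (snd C) = com_comp \<aa> C D E q g p' (com_comp \<aa> C C D p f 1 (snd C))"
    using assms d by (intro com_assoc) auto
  have c: "com_comp \<aa> C D E q' (com_comp \<aa> D D E q g 1 (snd D)) p f = com_comp \<aa> C D E q g p' (com_comp \<aa> C D D 1 (snd D) p f)"
    using assms d by (intro com_assoc) auto
  have i: "com_comp \<aa> D E E 1 (snd E) q g \<in> com_hom \<aa> D E q'" "com_comp \<aa> D D E q g 1 (snd D) \<in> com_hom \<aa> D E q'"
     "com_comp \<aa> C C D p f 1 (snd C) \<in> com_hom \<aa> C D p'" "com_comp \<aa> C D D 1 (snd D) p f \<in> com_hom \<aa> C D p'"
    using assms d by (auto intro!: com_comp_in)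
  note j = com_hom_ops(3)[OF CDE(2,3) i(2)] com_hom_ops(3)[OF CDE(1,2) i(3)]
  show ?thesis unfolding com_d_def a b using i j assms c
    by (auto simp: koszul_def com_comp_diff com_comp_add)
qed

lemma com_class_eq:
  assumes CD: "C \<in> complexes \<aa>" "D \<in> complexes \<aa>" and f: "f \<in> com_hom \<aa> C D n"
  shows "com_class \<aa> C D n f = com_class \<aa> C D n g \<longleftrightarrow> f \<in> com_class \<aa> C D n g"
proof
  assume a: "com_class \<aa> C D n f = com_class \<aa> C D n g"
  have "f \<in> com_class \<aa> C D n f"
    using f com_d_0[OF CD] com_hom_ops[OF CD] by (auto simp: com_class_def intro!: image_eqI[of _ _ 0])
  then show "f \<in> com_class \<aa> C D n g" using a by simp
next
  assume "f \<in> com_class \<aa> C D n g"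
  then obtain u where u: "u \<in> com_hom \<aa> C D (n-1)" "f - g = com_d \<aa> C D (n-1) u"
    by (auto simp: com_class_def)
  have "x - f \<in> com_d \<aa> C D (n-1) ` com_hom \<aa> C D (n-1) \<longleftrightarrow> x - g \<in> com_d \<aa> C D (n-1) ` com_hom \<aa> C D (n-1)" for x
  proof
    assume "x - f \<in> com_d \<aa> C D (n-1) ` com_hom \<aa> C D (n-1)"
    then obtain v where v: "v \<in> com_hom \<aa> C D (n-1)" "x - f = com_d \<aa> C D (n-1) v" by auto
    have "x - g = com_d \<aa> C D (n-1) (v + u)"
      using com_d_add[OF CD v(1) u(1)] u v by (simp add: algebra_simps)
    then show "x - g \<in> com_d \<aa> C D (n-1) ` com_hom \<aa> C D (n-1)"
      using com_hom_ops[OF CD] u v by blast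
  next
    assume "x - g \<in> com_d \<aa> C D (n-1) ` com_hom \<aa> C D (n-1)"
    then obtain v where v: "v \<in> com_hom \<aa> C D (n-1)" "x - g = com_d \<aa> C D (n-1) v" by auto
    have "x - f = com_d \<aa> C D (n-1) (v - u)"
      using com_d_add[OF CD v(1) u(1)] u v by (simp add: algebra_simps)
    then show "x - f \<in> com_d \<aa> C D (n-1) ` com_hom \<aa> C D (n-1)"
      using com_hom_ops[OF CD] u v by blast
  qed
  then show "com_class \<aa> C D n f = com_class \<aa> C D n g" by (auto simp: com_class_def)
qed

lemma ob_cocycle:
  assumes c: "c \<in> hh_cocycles \<aa> 2" and C: "C \<in> complexes \<aa>"
  shows "obstruction_cochain \<aa> c C \<in> com_cocycles \<aa> C C 2"
proof -
  have c': "c \<in> hh_cochains \<aa> 2" using c by (simp add: cocycles_def)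
  note [simp] = cpx_ob[OF C]
  have d [simp]: "snd C i \<in> Hom \<aa> (fst C i) (fst C j)" if "j = i + 1" for i j using cpx_d[OF C] that by simp
  have dd: "comp \<aa> (fst C i) (fst C (i + 1)) (fst C (i + 2)) (snd C (i + 1)) (snd C i) = 0" for i
    using cpx_dd[OF C] .
  have i[simp]: "c [fst C (i+2), fst C (i+1), fst C i] [(0,snd C (i+1)), (0,snd C i)] \<in> Hom \<aa> (fst C i) (fst C (i+2))" for i
    by (rule c2_in[OF c']) auto
  have i3[simp]: "c [fst C (i+3), fst C (i+2), fst C (i+1)] [(0,snd C (i+2)), (0,snd C (i+1))] \<in> Hom \<aa> (fst C (i+1)) (fst C (i+3))" for i
    by (rule c2_in[OF c']) auto
  have z1: "c [fst C (i+3), fst C (i+1), fst C i] [(0,0), (0,snd C i)] = 0" for i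
    using c2_scal[OF c', of "fst C i" "fst C (i+1)" "fst C (i+3)" 0 "snd C i" 0] by (simp add: H0)
  have z2: "c [fst C (i+3), fst C (i+2), fst C i] [(0,snd C (i+2)), (0,0)] = 0" for i
    using c2_scar[OF c', of "fst C i" "fst C (i+2)" "fst C (i+3)" "snd C (i+2)" 0 0] by (simp add: H0)
  have "com_d \<aa> C C 2 (obstruction_cochain \<aa> c C) i = 0" for i
    using c_cocycle[OF c, of "fst C i" "fst C (i+1)" "fst C (i+2)" "fst C (i+3)" "snd C (i+2)" "snd C (i+1)" "snd C i"]
      dd[of i] dd[of "i+1"] i[of i] i3[of i] i[of "i+1"]
    by (simp add: obstruction_cochain_eq[OF C] com_d_def com_comp_def koszul_def add.assoc compnl compnr z1 z2)
  then show ?thesis unfolding com_cocycles_def com_hom_def by (auto simp: obstruction_cochain_eq[OF C] fun_eq_iff intro!: Hneg)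
qed

lemma obstruction_natural_aux:
  assumes c: "c \<in> hh_cocycles \<aa> 2"
   and ob: "a0 \<in> Ob \<aa>" "a1 \<in> Ob \<aa>" "a2 \<in> Ob \<aa>" "b0 \<in> Ob \<aa>" "b1 \<in> Ob \<aa>" "b2 \<in> Ob \<aa>"
   and h: "x0 \<in> Hom \<aa> a0 a1" "x1 \<in> Hom \<aa> a1 a2" "y0 \<in> Hom \<aa> b0 b1" "y1 \<in> Hom \<aa> b1 b2"
     "f0 \<in> Hom \<aa> a0 b0" "f1 \<in> Hom \<aa> a1 b1" "f2 \<in> Hom \<aa> a2 b2"
   and e: "comp \<aa> a0 b0 b1 y0 f0 = scal \<aa> s (comp \<aa> a0 a1 b1 f1 x0)" "comp \<aa> a1 b1 b2 y1 f1 = scal \<aa> s (comp \<aa> a1 a2 b2 f2 x1)"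
     "comp \<aa> a0 a1 a2 x1 x0 = 0" "comp \<aa> b0 b1 b2 y1 y0 = 0" and s: "s * s = 1"
  shows "comp \<aa> a0 b0 b2 (c [b2,b1,b0] [(0,y1),(0,y0)]) f0 - comp \<aa> a0 a2 b2 f2 (c [a2,a1,a0] [(0,x1),(0,x0)])
    = comp \<aa> a0 b1 b2 y1 (c [b1,b0,a0] [(0,y0),(0,f0)] - scal \<aa> s (c [b1,a1,a0] [(0,f1),(0,x0)]))
      + scal \<aa> s (comp \<aa> a0 a1 b2 (c [b2,b1,a1] [(0,y1),(0,f1)] - scal \<aa> s (c [b2,a2,a1] [(0,f2),(0,x1)])) x0)"
proof -
  have c': "c \<in> hh_cochains \<aa> 2" using c by (simp add: cocycles_def)
  note [simp] = ob h comp_in_Hom c2_in[OF c'] Hscal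
  have z1: "c [b2, b0, a0] [(0,0), (0,f0)] = 0"
    using c2_scal[OF c', of a0 b0 b2 0 f0 0] by (simp add: H0)
  have z2: "c [b2, a2, a0] [(0,f2), (0,0)] = 0"
    using c2_scar[OF c', of a0 a2 b2 f2 0 0] by (simp add: H0)
  have 1: "comp \<aa> a0 b0 b2 (c [b2,b1,b0] [(0,y1),(0,y0)]) f0 = comp \<aa> a0 b1 b2 y1 (c [b1,b0,a0] [(0,y0),(0,f0)])
     + scal \<aa> s (c [b2,b1,a0] [(0,y1),(0,comp \<aa> a0 a1 b1 f1 x0)])"
    using c_cocycle[OF c, of a0 b0 b1 b2 y1 y0 f0] e z1 by (simp add: c2_scar[OF c'] algebra_simps)
  have 2: "comp \<aa> a0 a2 b2 f2 (c [a2,a1,a0] [(0,x1),(0,x0)]) = c [b2,a1,a0] [(0,comp \<aa> a1 a2 b2 f2 x1),(0,x0)]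
     + comp \<aa> a0 a1 b2 (c [b2,a2,a1] [(0,f2),(0,x1)]) x0"
    using c_cocycle[OF c, of a0 a1 a2 b2 f2 x1 x0] e z2 by (simp add: algebra_simps)
  have 3: "c [b2,b1,a0] [(0,y1),(0,comp \<aa> a0 a1 b1 f1 x0)] = scal \<aa> s (c [b2,a1,a0] [(0,comp \<aa> a1 a2 b2 f2 x1),(0,x0)])
     - comp \<aa> a0 b1 b2 y1 (c [b1,a1,a0] [(0,f1),(0,x0)]) + comp \<aa> a0 a1 b2 (c [b2,b1,a1] [(0,y1),(0,f1)]) x0"
    using c_cocycle[OF c, of a0 a1 b1 b2 y1 f1 x0] e by (simp add: c2_scal[OF c'] algebra_simps)
  show ?thesis unfolding 1 2 3
    by (simp add: compdl compdr comp_scal_left comp_scal_right vs.scale_right_distrib vs.scale_right_diff_distrib s)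
qed

lemma obstruction_natural:
  assumes c: "c \<in> hh_cocycles \<aa> 2" and C: "C \<in> complexes \<aa>" and D: "D \<in> complexes \<aa>"
   and f: "f \<in> com_cocycles \<aa> C D p" and n: "n = p + 2"
  shows "com_class \<aa> C D n (com_comp \<aa> C D D 2 (obstruction_cochain \<aa> c D) p f) = com_class \<aa> C D n (com_comp \<aa> C C D p f 2 (obstruction_cochain \<aa> c C))"
proof -
  define s where "s = (if even p then 1 else -1 :: 'k)"
  have ks: "koszul p x = (\<lambda>i. scal \<aa> s (x i))" for x :: "int \<Rightarrow> 'm" by (auto simp: koszul_def s_def fun_eq_iff)
  have ks1: "koszul (p+1) x = (\<lambda>i. - scal \<aa> s (x i))" for x :: "int \<Rightarrow> 'm" by (auto simp: koszul_def s_def fun_eq_iff)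
  have ss: "s * s = 1" by (auto simp: s_def)
  have c': "c \<in> hh_cochains \<aa> 2" using c by (simp add: cocycles_def)
  have fh: "f \<in> com_hom \<aa> C D p" using f by (simp add: com_cocycles_def)
  note [simp] = cpx_ob[OF C] cpx_ob[OF D]
  have d [simp]: "snd C i \<in> Hom \<aa> (fst C i) (fst C j)" if "j = i + 1" for i j using cpx_d[OF C] that by simp
  have e [simp]: "snd D i \<in> Hom \<aa> (fst D i) (fst D j)" if "j = i + 1" for i j using cpx_d[OF D] that by simp
  have f1 [simp]: "f i \<in> Hom \<aa> (fst C i) (fst D j)" if "j = i + p" for i j using com_homD[OF fh] that by simp
  define A where "A = (\<lambda>i. - (c [fst D (i+p+1), fst D (i+p), fst C i] [(0,snd D (i+p)),(0,f i)]
     - scal \<aa> s (c [fst D (i+p+1), fst C (i+1), fst C i] [(0,f (i+1)),(0,snd C i)])))"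
  have A: "A \<in> com_hom \<aa> C D (n - 1)"
    unfolding A_def com_hom_def using n by (auto simp: ac_simps intro!: Hneg Hdiff Hscal c2_in[OF c'])
  have df: "comp \<aa> (fst C i) (fst D (i+p)) (fst D (i+p+1)) (snd D (i+p)) (f i) =
     scal \<aa> s (comp \<aa> (fst C i) (fst C (i+1)) (fst D (i+p+1)) (f (i+1)) (snd C i))" for i
  proof -
    have r: "i + 1 + p = i + p + 1" by simp
    have "com_d \<aa> C D p f i = 0" using f by (simp add: com_cocycles_def)
    then show ?thesis unfolding com_d_def com_comp_def ks by (simp only: r fun_diff_def eq_iff_diff_eq_0[symmetric])
  qed
  have eq: "com_comp \<aa> C D D 2 (obstruction_cochain \<aa> c D) p f - com_comp \<aa> C C D p f 2 (obstruction_cochain \<aa> c C) = com_d \<aa> C D (n - 1) A"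
  proof
    fix i
    have n1: "n - 1 = p + 1" using n by simp
    have ci: "c [fst D (i + p + 2), fst D (i+p+1), fst D (i+p)] [(0, snd D (i+p+1)), (0, snd D (i+p))] \<in> Hom \<aa> (fst D (i+p)) (fst D (i+p+2))"
      "c [fst C (i + 2), fst C (i+1), fst C i] [(0, snd C (i+1)), (0, snd C i)] \<in> Hom \<aa> (fst C i) (fst C (i+2))"
      by (auto intro!: c2_in[OF c'])
    have mA: "c [fst D (i+p+1), fst D (i+p), fst C i] [(0,snd D (i+p)),(0,f i)]
     - scal \<aa> s (c [fst D (i+p+1), fst C (i+1), fst C i] [(0,f (i+1)),(0,snd C i)]) \<in> Hom \<aa> (fst C i) (fst D (i+p+1))" for i
      by (auto simp: ac_simps intro!: Hneg Hdiff Hscal c2_in[OF c'])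
    have ar: "i + 1 + p = i + p + 1" "i + 2 + p = i + p + 2" "i + (p + 1) = i + p + 1" "i + 1 + p + 1 = i + p + 2"  "i + p + 1 + 1 = i + p + 2" "i + 1 + (p + 1) = i + p + 2" "i + 1 + 1 = i + 2"
      by simp_all
    have n': "comp \<aa> (fst C i) (fst D (i+p)) (fst D (i+p+2)) (c [fst D (i + p + 2), fst D (i+p+1), fst D (i+p)] [(0, snd D (i+p+1)), (0, snd D (i+p))]) (f i)
      - comp \<aa> (fst C i) (fst C (i+2)) (fst D (i+p+2)) (f (i+2)) (c [fst C (i + 2), fst C (i+1), fst C i] [(0, snd C (i+1)), (0, snd C i)])
     = comp \<aa> (fst C i) (fst D (i+p+1)) (fst D (i+p+2)) (snd D (i+p+1)) (c [fst D (i+p+1), fst D (i+p), fst C i] [(0,snd D (i+p)),(0,f i)]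
     - scal \<aa> s (c [fst D (i+p+1), fst C (i+1), fst C i] [(0,f (i+1)),(0,snd C i)]))
      + scal \<aa> s (comp \<aa> (fst C i) (fst C (i+1)) (fst D (i+p+2)) (c [fst D (i+p+2), fst D (i+p+1), fst C (i+1)] [(0,snd D (i+p+1)),(0,f (i+1))]
     - scal \<aa> s (c [fst D (i+p+2), fst C (i+2), fst C (i+1)] [(0,f (i+2)),(0,snd C (i+1))])) (snd C i))"
      by (rule obstruction_natural_aux[OF c]) (use df[of i] df[of "i+1"] cpx_dd[OF C, of i] cpx_dd[OF D, of "i+p"] ss in \<open>auto simp: ar\<close>)
    show "(com_comp \<aa> C D D 2 (obstruction_cochain \<aa> c D) p f - com_comp \<aa> C C D p f 2 (obstruction_cochain \<aa> c C)) i = com_d \<aa> C D (n - 1) A i"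
      using n' unfolding n1 obstruction_cochain_eq[OF C] obstruction_cochain_eq[OF D] com_comp_def com_d_def A_def ks1
      unfolding fun_diff_def fun_Compl_def ar
      unfolding compnl[OF cpx_ob[OF C] cpx_ob[OF D] cpx_ob[OF D] f1[OF refl] ci(1)]
         compnr[OF cpx_ob[OF C] cpx_ob[OF C] cpx_ob[OF D] ci(2) f1[of "i+p+2" "i+2", unfolded ar, OF refl]]
         compnr[OF cpx_ob[OF C] cpx_ob[OF D] cpx_ob[OF D] mA[of i] e[of "i+p+2" "i+p+1", unfolded ar, OF refl]]
         compnl[OF cpx_ob[OF C] cpx_ob[OF C] cpx_ob[OF D] d[OF refl] mA[of "i+1", unfolded ar]]
      by (simp only: vs.scale_minus_right minus_diff_minus diff_minus_eq_add minus_minus minus_add_distrib) (simp add: algebra_simps del: minus_diff_eq)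
  qed
  have "com_comp \<aa> C D D 2 (obstruction_cochain \<aa> c D) p f \<in> com_class \<aa> C D n (com_comp \<aa> C C D p f 2 (obstruction_cochain \<aa> c C))"
    unfolding com_class_def using eq A com_comp_in[OF C D D _ fh n] ob_cocycle[OF c D] by (auto simp: com_cocycles_def)
  then show ?thesis using com_class_eq[OF C D] com_comp_in[OF C D D _ fh n] ob_cocycle[OF c D] by (auto simp: com_cocycles_def)
qed

lemma linear_category_deformation:
  assumes c: "c \<in> hh_cocycles \<aa> 2"
  shows "linear_category (deformation \<aa> c)"
proof -
  have c': "c \<in> hh_cochains \<aa> 2" using c by (simp add: cocycles_def)
  note [simp] = comp_in_Hom c2_in[OF c'] Hscal Hadd Hneg Hdiff ident_in_Hom
  have vs: "vector_space (\<lambda>r (f, f'). (scal \<aa> r f, scal \<aa> r f'))"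
    by (auto simp: vector_space_def vs.scale_right_distrib vs.scale_left_distrib)
  interpret vs2: vector_space "\<lambda>r (f, f'). (scal \<aa> r f, scal \<aa> r f')" by (rule vs)
  have l: "c [B,B,A] [(0,ident \<aa> B),(0,f)] = comp \<aa> A B B (c [B,B,B] [(0,ident \<aa> B),(0,ident \<aa> B)]) f"
    if "A \<in> Ob \<aa>" "B \<in> Ob \<aa>" "f \<in> Hom \<aa> A B" for A B f
    using c_cocycle[OF c, of A B B B "ident \<aa> B" "ident \<aa> B" f] that by (simp add: comp_ident_left)
  have r: "c [B,A,A] [(0,f),(0,ident \<aa> A)] = comp \<aa> A A B f (c [A,A,A] [(0,ident \<aa> A),(0,ident \<aa> A)])"
    if "A \<in> Ob \<aa>" "B \<in> Ob \<aa>" "f \<in> Hom \<aa> A B" for A B f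
    using c_cocycle[OF c, of A A A B f "ident \<aa> A" "ident \<aa> A"] that by (simp add: comp_ident_right comp_ident_left)
  show ?thesis
    apply (rule linear_category.intro)
    subgoal using vs by (simp add: deformation_def)
    subgoal by (auto simp: deformation_def vs2.subspace_def H0 zero_prod_def)
    subgoal by (auto simp: deformation_def)
    subgoal by (auto simp: deformation_def comp_add_left c2_addl[OF c'])
    subgoal by (auto simp: deformation_def comp_add_right c2_addr[OF c'])
    subgoal by (auto simp: deformation_def comp_scal_left c2_scal[OF c'] vs.scale_right_distrib)
    subgoal by (auto simp: deformation_def comp_scal_right c2_scar[OF c'] vs.scale_right_distrib)
    subgoal premises prems for A B C D h g f
      using prems c_cocycle[OF c, of A B C D "fst h" "fst g" "fst f"]
      by (auto simp: deformation_def comp_add_left comp_add_right comp_assoc algebra_simps)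
    subgoal by (auto simp: deformation_def)
    subgoal premises prems for A B f
      using prems l[of A B "fst f"] by (auto simp: deformation_def comp_ident_left compnl)
    subgoal premises prems for A B f
      using prems r[of A B "fst f"] by (auto simp: deformation_def comp_ident_right compnr)
    done
qed

lemma c_deformation_strict_iff:
  assumes c: "c \<in> hh_cocycles \<aa> 2" and C: "C \<in> complexes \<aa>"
  shows "(fst C, \<lambda>i. (snd C i, h i)) \<in> complexes (deformation \<aa> c) \<longleftrightarrow> h \<in> com_hom \<aa> C C 1 \<and> com_d \<aa> C C 1 h = obstruction_cochain \<aa> c C"
proof -
  have c': "c \<in> hh_cochains \<aa> 2" using c by (simp add: cocycles_def)
  have "com_d \<aa> C C 1 h = obstruction_cochain \<aa> c C \<longleftrightarrow> (\<forall>i. comp \<aa> (fst C i) (fst C (i+1)) (fst C (i+2)) (snd C (i+1)) (h i)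
     + comp \<aa> (fst C i) (fst C (i+1)) (fst C (i+2)) (h (i+1)) (snd C i) + c [fst C (i+2), fst C (i+1), fst C i] [(0,snd C (i+1)), (0,snd C i)] = 0)"
    unfolding obstruction_cochain_eq[OF C] by (simp add: com_d_def com_comp_def koszul_def fun_eq_iff eq_neg_iff_add_eq_0 add.assoc)
  then show ?thesis
    using cpx[OF C] by (auto simp: complexes_def deformation_def com_hom_def zero_prod_def)
qed

lemma ident_hom: "C \<in> complexes \<aa> \<Longrightarrow> (\<lambda>i. ident \<aa> (fst C i)) \<in> com_hom \<aa> C C 0"
  by (simp add: com_hom_def ident_in_Hom cpx_ob)

lemma ident_coc: "C \<in> complexes \<aa> \<Longrightarrow> (\<lambda>i. ident \<aa> (fst C i)) \<in> com_cocycles \<aa> C C 0"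
  by (simp add: com_cocycles_def ident_hom com_d_def com_comp_def koszul_def fun_eq_iff comp_ident_left comp_ident_right cpx_ob cpx_d)

lemma comp_ident_com: "C \<in> complexes \<aa> \<Longrightarrow> D \<in> complexes \<aa> \<Longrightarrow> f \<in> com_hom \<aa> C D n \<Longrightarrow> com_comp \<aa> C D D 0 (\<lambda>i. ident \<aa> (fst D i)) n f = f"
   "C \<in> complexes \<aa> \<Longrightarrow> D \<in> complexes \<aa> \<Longrightarrow> f \<in> com_hom \<aa> C D n \<Longrightarrow> com_comp \<aa> C C D n f 0 (\<lambda>i. ident \<aa> (fst C i)) = f"
  by (auto simp: com_comp_def com_hom_def fun_eq_iff comp_ident_left comp_ident_right cpx_ob)

lemma K_iso_refl: "C \<in> complexes \<aa> \<Longrightarrow> K_iso \<aa> C C"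
  unfolding K_iso_def using ident_coc ident_hom comp_ident_com by metis

lemma com_class_self: "C \<in> complexes \<aa> \<Longrightarrow> D \<in> complexes \<aa> \<Longrightarrow> f \<in> com_hom \<aa> C D n \<Longrightarrow> f \<in> com_class \<aa> C D n f"
  using com_class_eq by blast

lemma com_classE: assumes "f \<in> com_class \<aa> C D n g" obtains u where "u \<in> com_hom \<aa> C D (n - 1)" "f = g + com_d \<aa> C D (n - 1) u"
  using assms by (auto simp: com_class_def) (metis add.commute diff_add_cancel)

lemma com_classI: "f \<in> com_hom \<aa> C D n \<Longrightarrow> u \<in> com_hom \<aa> C D (n - 1) \<Longrightarrow> f - g = com_d \<aa> C D (n - 1) u \<Longrightarrow> f \<in> com_class \<aa> C D n g"
  by (auto simp: com_class_def)

lemma has_c_deformation_iff: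
  assumes c: "c \<in> hh_cocycles \<aa> 2" and C: "C \<in> complexes \<aa>"
  shows "has_c_deformation \<aa> c C \<longleftrightarrow> obstruction \<aa> c C = com_class \<aa> C C 2 0"
proof
  have obh: "obstruction_cochain \<aa> c C \<in> com_hom \<aa> C C 2" using ob_cocycle[OF c C] by (simp add: com_cocycles_def)
  { assume "obstruction \<aa> c C = com_class \<aa> C C 2 0"
    then have "obstruction_cochain \<aa> c C \<in> com_class \<aa> C C 2 0" unfolding obstruction_def using com_class_eq[OF C C obh] by blast
    then obtain h where "h \<in> com_hom \<aa> C C 1" "com_d \<aa> C C 1 h = obstruction_cochain \<aa> c C" by (auto simp: com_class_def)
    then have "(fst C, \<lambda>i. (snd C i, h i)) \<in> complexes (deformation \<aa> c)" using c_deformation_strict_iff[OF c C] by blast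
    moreover have "K_iso \<aa> (fst C, fst \<circ> (\<lambda>i. (snd C i, h i))) C" using K_iso_refl[OF C] by (simp add: o_def)
    ultimately show "has_c_deformation \<aa> c C" unfolding has_c_deformation_def by fast
  }
  { assume "has_c_deformation \<aa> c C"
    then obtain E e where E: "(E, e) \<in> complexes (deformation \<aa> c)" and K: "K_iso \<aa> (E, fst \<circ> e) C"
      unfolding has_c_deformation_def by fast
    define D where "D = (E, fst \<circ> e)"
    have D: "D \<in> complexes \<aa>" using E by (auto simp: D_def complexes_def deformation_def case_prod_unfold prod_eq_iff mem_Times_iff)
    have "(fst D, \<lambda>i. (snd D i, snd (e i))) \<in> complexes (deformation \<aa> c)" using E by (simp add: D_def)
    then have h: "(\<lambda>i. snd (e i)) \<in> com_hom \<aa> D D 1" "com_d \<aa> D D 1 (\<lambda>i. snd (e i)) = obstruction_cochain \<aa> c D" using c_deformation_strict_iff[OF c D] by auto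
    define h where "h = (\<lambda>i. snd (e i))"
    note h = h[folded h_def]
    obtain f g where f: "f \<in> com_cocycles \<aa> D C 0" and g: "g \<in> com_cocycles \<aa> C D 0"
      and fg: "com_class \<aa> C C 0 (com_comp \<aa> C D C 0 f 0 g) = com_class \<aa> C C 0 (\<lambda>i. ident \<aa> (fst C i))"
      using K unfolding K_iso_def D_def[symmetric] by auto
    have fh: "f \<in> com_hom \<aa> D C 0" "g \<in> com_hom \<aa> C D 0" "com_d \<aa> D C 0 f = 0" "com_d \<aa> C D 0 g = 0" using f g by (auto simp: com_cocycles_def)
    have fgh: "com_comp \<aa> C D C 0 f 0 g \<in> com_hom \<aa> C C 0" by (rule com_comp_in[OF C D C fh(1,2)]) simp
    have "com_comp \<aa> C D C 0 f 0 g \<in> com_class \<aa> C C 0 (\<lambda>i. ident \<aa> (fst C i))"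
      using fg com_class_eq[OF C C fgh] by simp
    then obtain u where u: "u \<in> com_hom \<aa> C C (- 1)" "com_comp \<aa> C D C 0 f 0 g = (\<lambda>i. ident \<aa> (fst C i)) + com_d \<aa> C C (- 1) u"
      by (elim com_classE) simp
    obtain v where v: "v \<in> com_hom \<aa> D C 1" "com_comp \<aa> D C C 2 (obstruction_cochain \<aa> c C) 0 f = com_comp \<aa> D D C 0 f 2 (obstruction_cochain \<aa> c D) + com_d \<aa> D C 1 v"
    proof -
      have "com_comp \<aa> D C C 2 (obstruction_cochain \<aa> c C) 0 f \<in> com_class \<aa> D C 2 (com_comp \<aa> D D C 0 f 2 (obstruction_cochain \<aa> c D))"
        using obstruction_natural[OF c D C f, of 2] com_class_self[OF D C com_comp_in[OF D C C obh fh(1)], of 2] by simp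
      then show ?thesis by (elim com_classE) (simp add: that)
    qed
    have obd: "com_d \<aa> C C 2 (obstruction_cochain \<aa> c C) = 0" using ob_cocycle[OF c C] by (simp add: com_cocycles_def)
    have obdD: "obstruction_cochain \<aa> c D \<in> com_hom \<aa> D D 2" using ob_cocycle[OF c D] by (simp add: com_cocycles_def)
    have fd: "com_comp \<aa> D D C 0 f 2 (obstruction_cochain \<aa> c D) = com_d \<aa> D C 1 (com_comp \<aa> D D C 0 f 1 h)"
      using leibniz[OF D D C fh(1) h(1), of 1 2 1] fh(3) h(2) com_comp_zero[OF D D C] h(1) by (simp add: koszul_def)
    define w where "w = com_comp \<aa> D D C 0 f 1 h + v"
    have w: "w \<in> com_hom \<aa> D C 1" unfolding w_def using com_comp_in[OF D D C fh(1) h(1)] com_hom_ops[OF D C] v by auto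
    have obf: "com_comp \<aa> D C C 2 (obstruction_cochain \<aa> c C) 0 f = com_d \<aa> D C 1 w"
      unfolding v(2) fd w_def using com_d_add[OF D C com_comp_in[OF D D C fh(1) h(1)] v(1)] by simp
    have "com_comp \<aa> C D C 2 (com_comp \<aa> D C C 2 (obstruction_cochain \<aa> c C) 0 f) 0 g = com_d \<aa> C C 1 (com_comp \<aa> C D C 1 w 0 g)"
      using leibniz[OF C D C w fh(2), of 1 1 2] fh(4) com_comp_zero[OF C D C] w obf by simp
    moreover have "com_comp \<aa> C D C 2 (com_comp \<aa> D C C 2 (obstruction_cochain \<aa> c C) 0 f) 0 g = com_comp \<aa> C C C 2 (obstruction_cochain \<aa> c C) 0 (com_comp \<aa> C D C 0 f 0 g)"
      by (rule com_assoc[OF C D C C obh fh(1,2)]) auto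
    moreover have "\<dots> = obstruction_cochain \<aa> c C + com_comp \<aa> C C C 2 (obstruction_cochain \<aa> c C) 0 (com_d \<aa> C C (-1) u)"
      unfolding u(2) using com_comp_add(2)[OF C C C obh ident_hom[OF C]] com_d_in[OF C C u(1)] comp_ident_com(2)[OF C C obh] by simp
    moreover have "com_comp \<aa> C C C 2 (obstruction_cochain \<aa> c C) 0 (com_d \<aa> C C (-1) u) = com_d \<aa> C C 1 (com_comp \<aa> C C C 2 (obstruction_cochain \<aa> c C) (-1) u)"
      using leibniz[OF C C C obh u(1), of 1 0 3] obd com_comp_zero[OF C C C] u(1) by (simp add: koszul_def)
    ultimately have "obstruction_cochain \<aa> c C = com_d \<aa> C C 1 (com_comp \<aa> C D C 1 w 0 g) - com_d \<aa> C C 1 (com_comp \<aa> C C C 2 (obstruction_cochain \<aa> c C) (-1) u)"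
      by (simp add: algebra_simps)
    also have "\<dots> = com_d \<aa> C C 1 (com_comp \<aa> C D C 1 w 0 g - com_comp \<aa> C C C 2 (obstruction_cochain \<aa> c C) (-1) u)"
      using com_d_add(3)[OF C C com_comp_in[OF C D C w fh(2)] com_comp_in[OF C C C obh u(1)], of 1] by simp
    finally have "obstruction_cochain \<aa> c C \<in> com_class \<aa> C C 2 0"
      using com_comp_in[OF C D C w fh(2), of 1] com_comp_in[OF C C C obh u(1), of 1] com_hom_ops[OF C C] obh by (intro com_classI) auto
    then show "obstruction \<aa> c C = com_class \<aa> C C 2 0" unfolding obstruction_def using com_class_eq[OF C C obh] by blast
  }
qed

lemma obstruction_in_graded_centre:
  assumes c: "c \<in> hh_cocycles \<aa> 2"
  shows "(\<lambda>C\<in>complexes \<aa>. obstruction \<aa> c C) \<in> graded_centre \<aa> 2"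
proof -
  have "com_class \<aa> C D (p + 2) (com_comp \<aa> C D D 2 y p f) = com_class \<aa> C D (p + 2) (koszul (2 * p) (com_comp \<aa> C C D p f 2 x))"
    if C: "C \<in> complexes \<aa>" and D: "D \<in> complexes \<aa>" and f: "f \<in> com_cocycles \<aa> C D p"
     and x: "x \<in> com_class \<aa> C C 2 (obstruction_cochain \<aa> c C)" and y: "y \<in> com_class \<aa> D D 2 (obstruction_cochain \<aa> c D)" for C D p f x y
  proof -
    have fh: "f \<in> com_hom \<aa> C D p" "com_d \<aa> C D p f = 0" using f by (auto simp: com_cocycles_def)
    have obh: "obstruction_cochain \<aa> c C \<in> com_hom \<aa> C C 2" "obstruction_cochain \<aa> c D \<in> com_hom \<aa> D D 2" using ob_cocycle[OF c C] ob_cocycle[OF c D] by (auto simp: com_cocycles_def)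
    have xy: "x \<in> com_hom \<aa> C C 2" "y \<in> com_hom \<aa> D D 2" using x y by (auto simp: com_class_def)
    obtain u where u: "u \<in> com_hom \<aa> C C 1" "x = obstruction_cochain \<aa> c C + com_d \<aa> C C 1 u" using com_classE[OF x] by auto
    obtain v where v: "v \<in> com_hom \<aa> D D 1" "y = obstruction_cochain \<aa> c D + com_d \<aa> D D 1 v" using com_classE[OF y] by auto
    have dv: "com_d \<aa> D D 1 v \<in> com_hom \<aa> D D 2" and du: "com_d \<aa> C C 1 u \<in> com_hom \<aa> C C 2"
      using com_d_in[OF D D v(1)] com_d_in[OF C C u(1)] by auto
    have i: "com_comp \<aa> C D D 1 v p f \<in> com_hom \<aa> C D (p+1)" "com_comp \<aa> C C D p f 1 u \<in> com_hom \<aa> C D (p+1)"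
      using com_comp_in[OF C D D v(1) fh(1), of "p+1"] com_comp_in[OF C C D fh(1) u(1), of "p+1"] by auto
    have 1: "com_comp \<aa> C D D 2 y p f - com_comp \<aa> C D D 2 (obstruction_cochain \<aa> c D) p f = com_d \<aa> C D (p+1) (com_comp \<aa> C D D 1 v p f)"
      using leibniz[OF C D D v(1) fh(1), of "p+1" "p+1" 2] fh com_comp_zero[OF C D D] v com_comp_add(1)[OF C D D obh(2) fh(1) dv] by simp
    have 2: "com_comp \<aa> C C D p f 2 x - com_comp \<aa> C C D p f 2 (obstruction_cochain \<aa> c C) = com_d \<aa> C D (p+1) (koszul p (com_comp \<aa> C C D p f 1 u))"
      using leibniz[OF C C D fh(1) u(1), of "p+1" 2 "p+1"] fh com_comp_zero[OF C C D] u com_comp_add(2)[OF C C D fh(1) obh(1) du]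
        com_d_add(2)[OF C D i(2) i(2)] by (auto simp: koszul_def)
    have A: "com_comp \<aa> C D D 2 y p f \<in> com_class \<aa> C D (p+2) (com_comp \<aa> C D D 2 (obstruction_cochain \<aa> c D) p f)"
      by (rule com_classI[OF com_comp_in[OF C D D xy(2) fh(1)]]) (use 1 i in \<open>auto simp: algebra_simps\<close>)
    have B: "com_comp \<aa> C C D p f 2 x \<in> com_class \<aa> C D (p+2) (com_comp \<aa> C C D p f 2 (obstruction_cochain \<aa> c C))"
      by (rule com_classI[OF com_comp_in[OF C C D fh(1) xy(1)]]) (use 2 com_hom_ops(5)[OF C D i(2)] in \<open>auto simp: algebra_simps\<close>)
    have "com_class \<aa> C D (p + 2) (com_comp \<aa> C D D 2 y p f) = com_class \<aa> C D (p + 2) (com_comp \<aa> C C D p f 2 x)"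
      using A B com_class_eq[OF C D com_comp_in[OF C D D xy(2) fh(1) refl]] com_class_eq[OF C D com_comp_in[OF C C D fh(1) xy(1)], of "p+2"]
      obstruction_natural[OF c C D f, of "p+2"] by (metis add.commute)
    then show ?thesis by (simp add: koszul_def)
  qed
  then show ?thesis using ob_cocycle[OF c] by (auto simp: graded_centre_def obstruction_def K_hom_def)
qed

end

end

theory Submission
  imports Defs
begin

text \<open>On a complex C, the arity zero part of \<open>embr\<close> feeds only copies of the
  differential \<delta> into c. With no other inputs, m copies can be inserted in exactly one way,
  and without sign because no input is passed (\<open>insertions_replicate_Nil\<close>). As c lives
  in arity 2, only m = 2 survives. So the characteristic cochain is c(\<delta>, \<delta>) with its
  suspension sign, which is the obstruction cochain itself, not just up to homotopy
  (\<open>char_cochain_eq_obstruction_cochain\<close>).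

  It remains to pass to classes. Adding the coboundary of \<theta> to c changes c(\<delta>,
  \<delta>) by a coboundary of endomorphisms of C, so all representatives yield the same obstruction
  class (\<open>obstruction_cohomologous\<close>). Since c is itself a representative
  (\<open>hh_class_refl\<close>), the value on its class is that obstruction.\<close>

lemma insertions_replicate_Nil:
  "insertions (replicate m (0, \<psi>)) [B] [] = [(0, replicate (Suc m) B, replicate m (1, \<psi> [B] []))]"
  by (induction m) auto

text \<open>Whichever block the inserted cochain consumes, its value becomes one entry of the
  resulting tuple.\<close>

lemma zero_in_insertions:
  "(s, Cs, ys) \<in> set (insertions [(q, 0)] Bs xs) \<Longrightarrow> 0 \<in> snd ` set ys"
proof (induction xs arbitrary: s Cs ys Bs)
  case (Cons x xs)
  then show ?case
    by (force simp: image_iff)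
qed simp

context linear_category
begin

lemma mult_zero:
  assumes "0 \<in> snd ` set xs"
  shows "mult \<aa> Bs xs = 0"
proof (cases "composable (quiver_of \<aa>) Bs xs \<and> length xs = 2")
  case True
  then obtain A B C x y where xs: "xs = [x, y]" and Bs: "Bs = [C, B, A]"
    by (fastforce simp: composable_def numeral_2_eq_2 length_Suc_conv)
  \<comment> \<open>An entry of nonzero degree is 0, hence also lies in the Hom-space, so
    \<open>comp0l\<close> and \<open>comp0r\<close> apply in every degree.\<close>
  have "A \<in> Ob \<aa>" "B \<in> Ob \<aa>" "C \<in> Ob \<aa>" "snd x \<in> Hom \<aa> B C" "snd y \<in> Hom \<aa> A B"
    using True H0 unfolding xs Bs by (auto simp: composable_2 quiver_of_def split: if_splits)
  then show ?thesis
    using assms True unfolding xs Bs by (auto simp: mult_def comp0l comp0r)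
qed (auto simp: mult_def)

text \<open>One brace of the bracket has the zero cochain outside; the other puts a zero entry into
  the bilinear \<open>mult\<close>.\<close>

lemma hochschild_d_zero: "hochschild_d (quiver_of \<aa>) (bar 2 (mult \<aa>)) n 0 = 0"
proof -
  have bar0: "bar m 0 = 0" for m :: int
    by (simp add: bar_def Let_def fun_eq_iff)
  have "brace (quiver_of \<aa>) (bar 2 (mult \<aa>)) [(q, 0)] Bs xs = 0" for q Bs xs
  proof -
    have "map (\<lambda>(s, Cs, ys). koszul s (bar 2 (mult \<aa>) Cs ys)) (insertions [(q, 0)] Bs xs) =
        map (\<lambda>_. 0) (insertions [(q, 0)] Bs xs)"
      by (auto simp del: insertions.simps simp: bar_def Let_def mult_zero[OF zero_in_insertions])
    then have "sum_list (map (\<lambda>(s, Cs, ys). koszul s (bar 2 (mult \<aa>) Cs ys)) (insertions [(q, 0)] Bs xs)) = 0"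
      by (simp only: sum_list_0)
    then show ?thesis
      by (simp only: brace_def if_cancel)
  qed
  moreover have "brace (quiver_of \<aa>) 0 \<Psi> Bs xs = 0" for \<Psi> Bs xs
    by (simp add: brace_def case_prod_unfold)
  ultimately have "bracket (quiver_of \<aa>) 1 (bar 2 (mult \<aa>)) (n - 1) 0 = 0"
    by (simp add: bracket_def fun_eq_iff)
  then show ?thesis
    by (simp add: hochschild_d_def bar0)
qed

text \<open>Stated for cochains because it is applied to every member of \<open>hh_class\<close>,
  and membership there only provides a cochain.\<close>

lemma char_cochain_eq_obstruction_cochain:
  assumes c: "c \<in> hh_cochains \<aa> 2" and C: "C \<in> complexes \<aa>"
  shows "char_cochain \<aa> 2 c C = obstruction_cochain \<aa> c C"
proof -
  have delta: "bar 1 (delta \<aa>) [C] [] = snd C"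
    using C by (simp add: bar_def koszul_def delta_def composable_Nil com_quiver_def)
  have brace: "brace (com_quiver \<aa>) (bar 2 (componentwise \<aa> c)) (replicate m (0, bar 1 (delta \<aa>))) [C] []
      = bar 2 (componentwise \<aa> c) (replicate (Suc m) C) (replicate m (1, snd C))" for m
    using C delta
    by (simp add: brace_def insertions_replicate_Nil composable_Nil com_quiver_def koszul_def)
  have vanish: "bar 2 (componentwise \<aa> c) Bs xs = 0" if "length xs \<noteq> 2" for Bs xs
    using that
    by (auto simp: bar_def componentwise_def concentrated[OF c] koszul_def Let_def fun_eq_iff)
  \<comment> \<open>On the empty tuple the sign exponent of the outer \<open>bar 2\<close> is 0, so
    only the inner \<open>bar\<close> contributes a sign.\<close>
  have "char_cochain \<aa> 2 c C =
      (\<Sum>m=0..2. bar 2 (componentwise \<aa> c) (replicate (Suc m) C) (replicate m (1, snd C)))"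
    by (simp add: char_cochain_def embr_def bar_def[of 2 "\<lambda>Bs xs. \<Sum>m=0..2. _ m Bs xs"] koszul_def brace
        del: replicate_Suc)
  also have "\<dots> = obstruction_cochain \<aa> c C"
    by (simp add: numeral_2_eq_2 vanish obstruction_cochain_def)
  finally show ?thesis .
qed

lemma coch1:
  assumes \<theta>: "\<theta> \<in> hh_cochains \<aa> 1" and ob: "X \<in> Ob \<aa>" "Y \<in> Ob \<aa>"
  shows c1_in: "f \<in> Hom \<aa> X Y \<Longrightarrow> \<theta> [Y, X] [(0, f)] \<in> Hom \<aa> X Y"
    and c1_zero: "\<theta> [Y, X] [(0, 0)] = 0"
proof -
  let ?Q = "quiver_of \<aa>"
  have cm: "composable ?Q [Y, X] [(0, f)]" if "f \<in> Hom \<aa> X Y" for f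
    using that ob by (simp add: composable_Cons composable_Nil quiver_of_def)
  have "\<theta> Bs xs \<in> qhom ?Q (last Bs) (hd Bs) (tdeg xs + (1 - int (length xs)))"
    if "composable ?Q Bs xs" for Bs xs
    using \<theta> that unfolding cochains_def by blast
  from this[OF cm] show "f \<in> Hom \<aa> X Y \<Longrightarrow> \<theta> [Y, X] [(0, f)] \<in> Hom \<aa> X Y"
    by (simp add: quiver_of_def tdeg_def)
  have "\<theta> Bs (us @ (p, x + y) # vs) = \<theta> Bs (us @ (p, x) # vs) + \<theta> Bs (us @ (p, y) # vs)"
    if "composable ?Q Bs (us @ (p, x) # vs)" "composable ?Q Bs (us @ (p, y) # vs)" for Bs us p x y vs
    using \<theta> that unfolding cochains_def multilinear_def by blast
  from this[of _ "[]" 0 0 "[]" 0] show "\<theta> [Y, X] [(0, 0)] = 0"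
    using cm[OF H0[OF ob]] by simp
qed

text \<open>The signs of \<open>bar\<close> and \<open>bracket\<close> combine to those of the
  classical coboundary; \<open>mult_conc\<close> and \<open>concentrated\<close> remove the
  insertions of wrong arity.\<close>

lemma hochschild_d_1:
  assumes \<theta>: "\<theta> \<in> hh_cochains \<aa> 1" and ob: "X \<in> Ob \<aa>" "Y \<in> Ob \<aa>" "Z \<in> Ob \<aa>"
    and g: "g \<in> Hom \<aa> Y Z" and f: "f \<in> Hom \<aa> X Y"
  shows "hochschild_d (quiver_of \<aa>) (bar 2 (mult \<aa>)) 1 \<theta> [Z, Y, X] [(0, g), (0, f)] =
    comp \<aa> X Y Z g (\<theta> [Y, X] [(0, f)]) + comp \<aa> X Y Z (\<theta> [Z, Y] [(0, g)]) f
      - \<theta> [Z, X] [(0, comp \<aa> X Y Z g f)]"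
  using ob g f c1_in[OF \<theta> ob(1,2) f] c1_in[OF \<theta> ob(2,3) g]
  by (simp add: hochschild_d_def bracket_def brace_def bar_def koszul_def composable_2
     quiver_of_def[of \<aa>, THEN arg_cong[of _ _ qob]] quiver_of_def[of \<aa>, THEN arg_cong[of _ _ qhom]]
     Let_def upt_rec[of _ "Suc _"] bdeg_def mult_conc mult2 concentrated[OF \<theta>] lessThan_Suc
     algebra_simps)

text \<open>Provides the nonemptiness that \<open>the_elem\<close> in \<open>char_morphism\<close>
  relies on.\<close>

lemma hh_class_refl:
  assumes "c \<in> hh_cochains \<aa> n"
  shows "c \<in> hh_class \<aa> n c"
proof -
  interpret vs: vector_space "scal \<aa>" by (rule vector_space_ambient)
  have "composable (quiver_of \<aa>) Bs xs \<Longrightarrow> 0 \<in> qhom (quiver_of \<aa>) (last Bs) (hd Bs) p" for Bs xs p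
    by (cases Bs) (auto simp: quiver_of_def composable_def intro!: H0)
  then have "0 \<in> hh_cochains \<aa> (n - 1)"
    by (auto simp: cochains_def multilinear_def quiver_of_def)
  then show ?thesis
    using assms hochschild_d_zero[of "n - 1"] by (force simp: hochschild_class_def image_iff)
qed

text \<open>Since \<open>\<delta>\<^sup>2 = 0\<close>, the coboundary of \<open>\<theta>\<close> evaluated at \<open>(\<delta>, \<delta>)\<close> reduces to \<open>\<delta> \<theta>(\<delta>) + \<theta>(\<delta>) \<delta>\<close>.\<close>

lemma obstruction_cohomologous:
  assumes C: "C \<in> complexes \<aa>" and c: "c \<in> hh_cochains \<aa> 2" and \<psi>: "\<psi> \<in> hh_class \<aa> 2 c"
  shows "obstruction \<aa> \<psi> C = obstruction \<aa> c C"
proof -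
  obtain \<theta> where \<theta>: "\<theta> \<in> hh_cochains \<aa> 1"
    and eq: "\<psi> - c = hochschild_d (quiver_of \<aa>) (bar 2 (mult \<aa>)) 1 \<theta>" and \<psi>': "\<psi> \<in> hh_cochains \<aa> 2"
    using \<psi> by (auto simp: hochschild_class_def)
  \<comment> \<open>The minus sign matches the one in \<open>obstruction_cochain_eq\<close>.\<close>
  define h where "h i = - \<theta> [fst C (i + 1), fst C i] [(0, snd C i)]" for i
  note [simp] = cpx_ob[OF C]
  have d [simp]: "snd C i \<in> Hom \<aa> (fst C i) (fst C j)" if "j = i + 1" for i j
    using cpx_d[OF C] that by simp
  have t [simp]: "\<theta> [fst C (i + 1), fst C i] [(0, snd C i)] \<in> Hom \<aa> (fst C i) (fst C (i + 1))" for i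
    by (rule c1_in[OF \<theta>]) auto
  have h: "h \<in> com_hom \<aa> C C 1"
    by (auto simp: com_hom_def h_def intro!: Hneg)
  have "obstruction_cochain \<aa> \<psi> C i - obstruction_cochain \<aa> c C i = com_d \<aa> C C 1 h i" for i
  proof -
    have "\<psi> [fst C (i+2), fst C (i+1), fst C i] [(0, snd C (i+1)), (0, snd C i)]
        - c [fst C (i+2), fst C (i+1), fst C i] [(0, snd C (i+1)), (0, snd C i)] =
      comp \<aa> (fst C i) (fst C (i+1)) (fst C (i+2)) (snd C (i+1)) (\<theta> [fst C (i+1), fst C i] [(0, snd C i)])
        + comp \<aa> (fst C i) (fst C (i+1)) (fst C (i+2)) (\<theta> [fst C (i+2), fst C (i+1)] [(0, snd C (i+1))]) (snd C i)"
      using fun_cong[OF fun_cong[OF eq]] hochschild_d_1[OF \<theta>] cpx_dd[OF C, of i]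
      by (simp add: c1_zero[OF \<theta>])
    then show ?thesis
      using t[of "i + 1"]
      by (simp add: obstruction_cochain_eq[OF C] com_d_def com_comp_def koszul_def h_def compnl compnr
          add.assoc algebra_simps)
  qed
  then have eq': "obstruction_cochain \<aa> \<psi> C - obstruction_cochain \<aa> c C = com_d \<aa> C C (2 - 1) h"
    by (simp add: fun_eq_iff)
  have ob: "obstruction_cochain \<aa> \<psi> C \<in> com_hom \<aa> C C 2"
    unfolding obstruction_cochain_eq[OF C] by (auto simp: com_hom_def intro!: Hneg c2_in[OF \<psi>'])
  show ?thesis
    unfolding obstruction_def com_class_eq[OF C C ob]
    using ob eq' h by (intro com_classI[of _ _ _ _ h]) auto
qed

end

theorem theorem4p8:
  fixes \<aa> :: "('k::field, 'o, 'm::ab_group_add) lincat"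
    and c :: "('o, 'm) cochain"
  assumes "linear_category \<aa>"
    and "c \<in> hh_cocycles \<aa> 2"
  shows "char_morphism \<aa> 2 (hh_class \<aa> 2 c) = (\<lambda>C\<in>complexes \<aa>. obstruction \<aa> c C)"
proof -
  interpret linear_category \<aa> by fact
  have c: "c \<in> hh_cochains \<aa> 2"
    using assms(2) by (simp add: cocycles_def)
  have "com_class \<aa> C C 2 (char_cochain \<aa> 2 \<psi> C) = obstruction \<aa> c C"
    if "\<psi> \<in> hh_class \<aa> 2 c" and C: "C \<in> complexes \<aa>" for \<psi> C
  proof -
    have "\<psi> \<in> hh_cochains \<aa> 2"
      using that by (simp add: hochschild_class_def)
    then show ?thesis
      using char_cochain_eq_obstruction_cochain[OF _ C] obstruction_cohomologous[OF C c that(1)]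
      by (simp add: obstruction_def)
  qed
  \<comment> \<open>The image has at most one element by the preceding fact, and it is nonempty
    because c represents its own class.\<close>
  then have "(\<lambda>\<psi>. com_class \<aa> C C 2 (char_cochain \<aa> 2 \<psi> C)) ` hh_class \<aa> 2 c = {obstruction \<aa> c C}"
    if "C \<in> complexes \<aa>" for C
    using hh_class_refl[OF c] that by auto
  then show ?thesis
    by (auto simp: char_morphism_def intro!: restrict_ext)
qed

end
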